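(* Let $k\ge 3$ be an integer. There exist constants $c=c(k)>0$ and $n_0=n_0(k)$ such that for every $n\ge n_0$: if $G$ is a graph on $n$ vertices with $q(G)\ge q(T_{n,k})$ and $G$ is not isomorphic to $T_{n,k}$, then $js_{k+1}(G)\ge c\,n^{k-1}$.
   Context: All graphs are finite and simple. $q(G)$ denotes the largest eigenvalue of the signless Laplacian $Q(G)=D(G)+A(G)$. $T_{n,k}$ is the complete $k$-partite graph on $n$ vertices with part sizes differing by at most one. An $r$-joint of size $t$ is a collection of $t$ copies of $K_r$ all containing a common edge; $js_r(G)$ is the maximum, over all edges $uv$ of $G$, of the number of copies of $K_r$ in $G$ containing both $u$ and $v$. *)

theory Defs
  imports Complex_Main
begin

definition graph :: "nat \<Rightarrow> (nat \<Rightarrow> nat \<Rightarrow> bool) \<Rightarrow> bool" where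
  "graph n E \<longleftrightarrow> (\<forall>i j. E i j \<longrightarrow> i < n \<and> j < n \<and> i \<noteq> j \<and> E j i)"

definition degree :: "nat \<Rightarrow> (nat \<Rightarrow> nat \<Rightarrow> bool) \<Rightarrow> nat \<Rightarrow> nat" where
  "degree n E i = card {j. j < n \<and> E i j}"

definition signless_laplacian :: "nat \<Rightarrow> (nat \<Rightarrow> nat \<Rightarrow> bool) \<Rightarrow> nat \<Rightarrow> nat \<Rightarrow> real" where
  "signless_laplacian n E i j =
     (if i = j then real (degree n E i) else if E i j then 1 else 0)"

definition eigenvalues :: "nat \<Rightarrow> (nat \<Rightarrow> nat \<Rightarrow> real) \<Rightarrow> real set" where
  "eigenvalues n M = {mu. \<exists>x :: nat \<Rightarrow> real. (\<exists>i<n. x i \<noteq> 0) \<and>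
      (\<forall>i<n. (\<Sum>j<n. M i j * x j) = mu * x i)}"

definition q :: "nat \<Rightarrow> (nat \<Rightarrow> nat \<Rightarrow> bool) \<Rightarrow> real" where
  "q n E = Max (eigenvalues n (signless_laplacian n E))"

text \<open>Turan graph T_{n,k}: vertex i lies in part (i mod k); parts have sizes
  differing by at most one.\<close>
definition turan :: "nat \<Rightarrow> nat \<Rightarrow> nat \<Rightarrow> nat \<Rightarrow> bool" where
  "turan n k i j \<longleftrightarrow> i < n \<and> j < n \<and> i mod k \<noteq> j mod k"

definition isomorphic :: "nat \<Rightarrow> (nat \<Rightarrow> nat \<Rightarrow> bool) \<Rightarrow> (nat \<Rightarrow> nat \<Rightarrow> bool) \<Rightarrow> bool" where
  "isomorphic n E F \<longleftrightarrow> (\<exists>f. bij_betw f {..<n} {..<n} \<and>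
      (\<forall>i<n. \<forall>j<n. E i j \<longleftrightarrow> F (f i) (f j)))"

definition cliques :: "nat \<Rightarrow> nat \<Rightarrow> (nat \<Rightarrow> nat \<Rightarrow> bool) \<Rightarrow> nat set set" where
  "cliques r n E = {S. S \<subseteq> {..<n} \<and> card S = r \<and> (\<forall>u\<in>S. \<forall>v\<in>S. u \<noteq> v \<longrightarrow> E u v)}"

definition js :: "nat \<Rightarrow> nat \<Rightarrow> (nat \<Rightarrow> nat \<Rightarrow> bool) \<Rightarrow> nat" where
  "js r n E = Max ({card {S \<in> cliques r n E. u \<in> S \<and> v \<in> S} | u v. u < n \<and> v < n \<and> E u v} \<union> {0})"

end

theory Submission
  imports Defs "HOL-Analysis.Analysis" "Jordan_Normal_Form.Spectral_Radius"
begin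

text \<open>Suppose every edge of \<open>G\<close> lies in few copies of \<open>K\<^bsub>k+1\<^esub>\<close>. Repeatedly delete the vertex with
  the least entry in the Perron vector of \<open>Q(G)\<close>. Each deletion does not decrease
  \<open>q(H) / (|H| - 1)\<close>, and increases it by at least \<open>\<kappa> / |H|\<close> as long as the minimum degree is below
  \<open>(1 - 1/k - \<epsilon>) |H|\<close>. Since this ratio never exceeds 2, the process stops at an \<open>H\<close> of linear
  order and large minimum degree.

  In such an \<open>H\<close> adjacent vertices have almost disjoint non-neighbourhoods, all of size about
  \<open>|H| / k\<close>, and this forces \<open>H\<close> to be \<open>k\<close>-partite. Then \<open>q(H) \<le> (2 - 2/k) |H|\<close>, which leaves no room
  for any deletion: \<open>H = G\<close>. Finally, for a \<open>k\<close>-partite graph with parts of sizes \<open>n\<^sub>i\<close> the eigenvalue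
  equation yields \<open>\<Sum> n\<^sub>i / (q - n + 2 n\<^sub>i) \<ge> 1\<close>, with equality exactly for complete \<open>k\<close>-partite
  graphs, and by strict concavity the left-hand side is largest for balanced parts.\<close>

section \<open>Few joints and large minimum degree\<close>

text \<open>A large \<open>q(G)\<close> by itself gives no lower bound on the minimum degree of
  \<open>G\<close>, so the colouring argument cannot be applied to \<open>G\<close> directly; this
  is why vertices are deleted. The normalisation by \<open>|H| - 1\<close> is that of complete
  graphs, where q is exactly \<open>2 * (|H| - 1)\<close>. The gain of one deletion is proportional
  to \<open>q(H) - |H|\<close>, so the ratio has to exceed 1 by a constant: for
  \<open>k \<ge> 3\<close> one has \<open>2 - 2/k \<ge> 4/3\<close>, while \<open>k = 2\<close>
  would leave no margin. Gains of \<kappa>/|H| add up to \<kappa> times a logarithm, and the cap 2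
  then gives |H| of order at least exp(-2/\<kappa>) n, whence the order n^(k-1) of the joints. The
  value \<epsilon> = 1/(20 k^5) is dictated by the colouring: its accumulated errors are at most 18
  k^4 \<epsilon> |H|, to be compared with the size |H|/k = 20 k^4 \<epsilon> |H| of a colour
  class.\<close>

locale ugraph =
  fixes E :: "'a \<Rightarrow> 'a \<Rightarrow> bool"
  assumes sym: "E i j \<Longrightarrow> E j i" and irrefl: "\<not> E i i"
begin

definition nbrs :: "'a set \<Rightarrow> 'a \<Rightarrow> 'a set" where
  "nbrs S u = {v \<in> S. E u v}"

text \<open>For \<open>u \<in> S\<close> this set contains \<open>u\<close> itself; in a complete
  multipartite graph it is exactly the part of \<open>u\<close>.\<close>

definition nonnbrs :: "'a set \<Rightarrow> 'a \<Rightarrow> 'a set" where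
  "nonnbrs S u = {v \<in> S. \<not> E u v}"

definition common_nbrs :: "'a set \<Rightarrow> 'a set \<Rightarrow> 'a set" where
  "common_nbrs S C = {w \<in> S. \<forall>v\<in>C. E v w}"

definition cliques_in :: "'a set \<Rightarrow> nat \<Rightarrow> 'a set set" where
  "cliques_in S r = {T. T \<subseteq> S \<and> card T = r \<and> (\<forall>u\<in>T. \<forall>v\<in>T. u \<noteq> v \<longrightarrow> E u v)}"

lemma finite_nbrs [simp]: "finite S \<Longrightarrow> finite (nbrs S u)"
  by (simp add: nbrs_def)

lemma finite_nonnbrs [simp]: "finite S \<Longrightarrow> finite (nonnbrs S u)"
  by (simp add: nonnbrs_def)

lemma finite_cliques_in: "finite S \<Longrightarrow> finite (cliques_in S r)"
  by (rule finite_subset[of _ "Pow S"]) (auto simp: cliques_in_def)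

lemma card_nonnbrs: "finite S \<Longrightarrow> card (nbrs S u) + card (nonnbrs S u) = card S"
  by (subst card_Un_disjoint[symmetric]) (auto simp: nbrs_def nonnbrs_def intro!: arg_cong[of _ _ card])

lemma card_common_nbrs:
  "finite S \<Longrightarrow> card (common_nbrs S C) + card (\<Union>v\<in>C. nonnbrs S v) = card S"
  by (subst card_Un_disjoint[symmetric])
    (auto simp: common_nbrs_def nonnbrs_def intro: finite_subset[of _ S] intro!: arg_cong[of _ _ card])

lemma card_UN_nonnbrs_le:
  assumes "finite C" "\<And>v. v \<in> C \<Longrightarrow> real (card (nonnbrs S v)) \<le> b"
  shows "real (card (\<Union>v\<in>C. nonnbrs S v)) \<le> real (card C) * b"
proof -
  have "real (card (\<Union>v\<in>C. nonnbrs S v)) \<le> (\<Sum>v\<in>C. real (card (nonnbrs S v)))"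
    using card_UN_le[OF assms(1), of "nonnbrs S"] by (metis of_nat_le_iff of_nat_sum)
  also have "\<dots> \<le> real (card C) * b"
    using assms by (intro sum_bounded_above) auto
  finally show ?thesis .
qed

lemma clique_insert:
  assumes "T \<in> cliques_in S r" "w \<in> common_nbrs S T" "finite S"
  shows "w \<notin> T" "insert w T \<in> cliques_in S (Suc r)"
proof -
  show "w \<notin> T"
    using assms irrefl by (auto simp: common_nbrs_def)
  moreover have "finite T"
    using assms by (auto simp: cliques_in_def intro: finite_subset)
  ultimately show "insert w T \<in> cliques_in S (Suc r)"
    using assms sym by (auto simp: cliques_in_def common_nbrs_def)
qed

text \<open>Greedy extension: fewer than \<open>k\<close> vertices have fewer than
  \<open>card S\<close> non-neighbours in total, so a common neighbour is left over.\<close>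

lemma ex_clique:
  assumes fin: "finite S" and b: "\<And>v. v \<in> S \<Longrightarrow> real (card (nonnbrs S v)) \<le> b"
    and large: "real (k - 1) * b < real (card S)" and "0 \<le> b" "j \<le> k"
  shows "cliques_in S j \<noteq> {}"
  using \<open>j \<le> k\<close>
proof (induction j)
  case 0
  show ?case by (auto simp: cliques_in_def intro: exI[of _ "{}"])
next
  case (Suc j)
  then obtain T where T: "T \<in> cliques_in S j" by auto
  have fT: "finite T" "card T = j" "T \<subseteq> S"
    using T fin by (auto simp: cliques_in_def intro: finite_subset)
  have "real (card (\<Union>v\<in>T. nonnbrs S v)) \<le> real j * b"
    using card_UN_nonnbrs_le[of T S b] fT b by auto
  also have "\<dots> \<le> real (k - 1) * b"
    using Suc.prems \<open>0 \<le> b\<close> by (intro mult_right_mono) auto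
  finally have "card (common_nbrs S T) > 0"
    using large card_common_nbrs[OF fin, of T] by linarith
  then obtain w where "w \<in> common_nbrs S T"
    by (auto simp: card_gt_0_iff)
  then show ?case using clique_insert[OF T _ fin] by blast
qed

text \<open>Count pairs of a clique \<open>T\<close> through \<open>uv\<close> and a common
  neighbour \<open>w\<close>. The map to \<open>(insert w T, w)\<close> is injective because
  \<open>w \<notin> T\<close>, and a larger clique is hit at most once for each of its vertices
  other than \<open>u\<close> and \<open>v\<close>, hence at most \<open>k\<close> times. Each
  extension therefore multiplies the count by at least \<open>\<gamma> / k\<close>.\<close>

lemma count_cliques:
  assumes fin: "finite S" and uv: "u \<in> S" "v \<in> S" "E u v" and "0 \<le> \<gamma>" "k \<ge> 1"
    and ext: "\<And>T r. T \<in> cliques_in S r \<Longrightarrow> u \<in> T \<Longrightarrow> v \<in> T \<Longrightarrow> r \<le> k \<Longrightarrow>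
      \<gamma> \<le> real (card (common_nbrs S T))"
    and "j + 1 \<le> k"
  shows "(\<gamma> / real k) ^ j \<le> real (card {T \<in> cliques_in S (j + 2). u \<in> T \<and> v \<in> T})"
  using \<open>j + 1 \<le> k\<close>
proof (induction j)
  case 0
  have "u \<noteq> v" using uv irrefl by auto
  then have "{u, v} \<in> {T \<in> cliques_in S (0 + 2). u \<in> T \<and> v \<in> T}"
    using uv sym by (auto simp: cliques_in_def)
  then have "card {T \<in> cliques_in S (0 + 2). u \<in> T \<and> v \<in> T} > 0"
    using finite_cliques_in[OF fin] by (subst card_gt_0_iff) auto
  then show ?case by simp
next
  case (Suc j)
  define F where "F i = {T \<in> cliques_in S (i + 2). u \<in> T \<and> v \<in> T}" for i
  have finF: "finite (F i)" for i
    using finite_cliques_in[OF fin] by (simp add: F_def)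
  have finT: "finite T" if "T \<in> F i" for T i
    using that fin by (auto simp: F_def cliques_in_def intro: finite_subset)
  have uv': "u \<noteq> v" using uv irrefl by auto
  have "real (card (F j)) * \<gamma> \<le> (\<Sum>T\<in>F j. real (card (common_nbrs S T)))"
    using Suc.prems by (intro sum_bounded_below) (auto simp: F_def intro!: ext)
  also have "\<dots> = real (card (SIGMA T:F j. common_nbrs S T))"
    using finF fin by (simp add: common_nbrs_def)
  also have "\<dots> \<le> real (card (SIGMA T:F (Suc j). T - {u, v}))"
  proof (intro of_nat_mono card_inj_on_le[of "\<lambda>(T, w). (insert w T, w)"])
    have nin: "w \<notin> T" if "T \<in> F j" "w \<in> common_nbrs S T" for T w
      using that clique_insert(1)[OF _ _ fin] by (auto simp: F_def)
    show "inj_on (\<lambda>(T, w). (insert w T, w)) (SIGMA T:F j. common_nbrs S T)"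
    proof (rule inj_onI)
      fix p p' assume p: "p \<in> (SIGMA T:F j. common_nbrs S T)" "p' \<in> (SIGMA T:F j. common_nbrs S T)"
        and eq: "(\<lambda>(T, w). (insert w T, w)) p = (\<lambda>(T, w). (insert w T, w)) p'"
      obtain T w T' w' where "p = (T, w)" "p' = (T', w')" by (meson surj_pair)
      then show "p = p'" using p eq nin[of T w] nin[of T' w] by auto
    qed
    show "(\<lambda>(T, w). (insert w T, w)) ` (SIGMA T:F j. common_nbrs S T) \<subseteq> (SIGMA T:F (Suc j). T - {u, v})"
    proof clarify
      fix T w assume *: "T \<in> F j" "w \<in> common_nbrs S T"
      then have T: "T \<in> cliques_in S (j + 2)" "u \<in> T" "v \<in> T" by (auto simp: F_def)
      show "insert w T \<in> F (Suc j) \<and> w \<in> insert w T - {u, v}"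
        using clique_insert[OF T(1) *(2) fin] T by (auto simp: F_def)
    qed
    show "finite (SIGMA T:F (Suc j). T - {u, v})"
      using finF finT by auto
  qed
  also have "\<dots> = (\<Sum>T\<in>F (Suc j). real (card (T - {u, v})))"
    using finF finT by simp
  also have "\<dots> \<le> real (card (F (Suc j))) * real k"
  proof (rule sum_bounded_above)
    fix T assume T: "T \<in> F (Suc j)"
    then have "card (T - {u, v}) = Suc j"
      using finT[OF T] uv' by (subst card_Diff_subset) (auto simp: F_def cliques_in_def)
    then show "real (card (T - {u, v})) \<le> real k" using Suc.prems by simp
  qed
  finally have step: "real (card (F j)) * \<gamma> \<le> real (card (F (Suc j))) * real k" .
  have "(\<gamma> / real k) ^ Suc j \<le> real (card (F j)) * (\<gamma> / real k)"
    unfolding power_Suc2 using Suc \<open>0 \<le> \<gamma>\<close> by (intro mult_right_mono) (auto simp: F_def)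
  also have "\<dots> \<le> real (card (F (Suc j)))"
    using step \<open>k \<ge> 1\<close> by (simp add: field_simps)
  finally show ?case by (simp add: F_def)
qed

text \<open>Bonferroni's inequality, with the number of pairs replaced by the cruder square of the
  number of sets.\<close>

lemma card_UN_ge_of_small_overlap:
  fixes A :: "'b \<Rightarrow> 'c set"
  assumes "finite C" "\<And>v. v \<in> C \<Longrightarrow> finite (A v)" "\<And>v. v \<in> C \<Longrightarrow> L \<le> real (card (A v))"
    and "\<And>v w. v \<in> C \<Longrightarrow> w \<in> C \<Longrightarrow> v \<noteq> w \<Longrightarrow> real (card (A v \<inter> A w)) \<le> t" "0 \<le> t"
  shows "real (card C) * L - real (card C) ^ 2 * t \<le> real (card (\<Union>v\<in>C. A v))"
  using assms
proof (induction C rule: finite_induct)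
  case (insert c C)
  have fin: "finite (A c)" "finite (\<Union>v\<in>C. A v)" using insert by auto
  have "real (card (A c \<inter> (\<Union>v\<in>C. A v))) = real (card (\<Union>v\<in>C. A c \<inter> A v))"
    by (simp only: Int_UN_distrib)
  also have "\<dots> \<le> (\<Sum>v\<in>C. real (card (A c \<inter> A v)))"
    using card_UN_le[OF insert(1), of "\<lambda>v. A c \<inter> A v"] by (metis of_nat_le_iff of_nat_sum)
  also have "\<dots> \<le> real (card C) * t"
    using insert by (intro sum_bounded_above) (metis insertCI)
  finally have 1: "real (card (A c \<inter> (\<Union>v\<in>C. A v))) \<le> real (card C) * t" .
  have 2: "real (card C) * L - real (card C) ^ 2 * t \<le> real (card (\<Union>v\<in>C. A v))"
    using insert by auto
  have 3: "real (card (A c)) + real (card (\<Union>v\<in>C. A v)) =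
     real (card (\<Union>v\<in>insert c C. A v)) + real (card (A c \<inter> (\<Union>v\<in>C. A v)))"
    using card_Un_Int[OF fin] by (simp flip: of_nat_add)
  have 4: "L \<le> real (card (A c))" using insert by auto
  have "real (card (insert c C)) * L - real (card (insert c C)) ^ 2 * t =
    (real (card C) * L - real (card C) ^ 2 * t) + L - (2 * real (card C) + 1) * t"
    using insert by (simp add: algebra_simps power2_eq_square)
  also have "\<dots> \<le> (real (card C) * L - real (card C) ^ 2 * t) + L - real (card C) * t"
    using \<open>0 \<le> t\<close> by (simp add: algebra_simps)
  finally show ?case using 1 2 3 4 by linarith
qed simp

text \<open>If the non-neighbourhoods of \<open>u\<close> and \<open>v\<close> overlapped more, the common neighbourhood of every
  clique of order at most \<open>k\<close> through \<open>uv\<close> would be linear, so that extending greedily yields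
  too many cliques.\<close>

lemma card_nonnbrs_Un_gt:
  assumes fin: "finite S" and "0 < \<epsilon>" "k \<ge> 2" and uv: "u \<in> S" "v \<in> S" "E u v"
    and deg: "\<And>v. v \<in> S \<Longrightarrow> real (card (nonnbrs S v)) \<le> (1 / real k + \<epsilon>) * real (card S)"
    and few: "real (card {T \<in> cliques_in S (k + 1). u \<in> T \<and> v \<in> T})
        < (2 * \<epsilon> * real (card S) / real k) ^ (k - 1)"
  shows "(2 / real k - real k * \<epsilon>) * real (card S) < real (card (nonnbrs S u \<union> nonnbrs S v))"
proof (rule ccontr)
  define m where "m = real (card S)"
  define b where "b = (1 / real k + \<epsilon>) * m"
  assume "\<not> ?thesis"
  then have small: "real (card (nonnbrs S u \<union> nonnbrs S v)) \<le> (2 / real k - real k * \<epsilon>) * m"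
    by (simp add: m_def)
  have b0: "0 \<le> b" using \<open>0 < \<epsilon>\<close> by (simp add: b_def m_def)
  have uv': "u \<noteq> v" using uv irrefl by auto
  have "(2 * \<epsilon> * m / real k) ^ (k - 1) \<le> real (card {T \<in> cliques_in S ((k - 1) + 2). u \<in> T \<and> v \<in> T})"
  proof (rule count_cliques[OF fin uv])
    fix T r assume T: "T \<in> cliques_in S r" "u \<in> T" "v \<in> T" "r \<le> k"
    have fT: "finite T" "T \<subseteq> S" "card T = r"
      using T fin by (auto simp: cliques_in_def intro: finite_subset)
    have c: "card (T - {u, v}) = r - 2"
      using T fT uv' by (subst card_Diff_subset) auto
    have "(\<Union>x\<in>T. nonnbrs S x) = (nonnbrs S u \<union> nonnbrs S v) \<union> (\<Union>x\<in>T - {u, v}. nonnbrs S x)"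
      using T by auto
    then have "real (card (\<Union>x\<in>T. nonnbrs S x)) \<le>
        real (card (nonnbrs S u \<union> nonnbrs S v)) + real (card (\<Union>x\<in>T - {u, v}. nonnbrs S x))"
      by (metis card_Un_le of_nat_add of_nat_le_iff)
    also have "real (card (\<Union>x\<in>T - {u, v}. nonnbrs S x)) \<le> real (r - 2) * b"
      using card_UN_nonnbrs_le[of "T - {u, v}" S b] fT deg c by (auto simp: b_def m_def)
    also have "real (r - 2) * b \<le> (real k - 2) * b"
      using \<open>r \<le> k\<close> \<open>k \<ge> 2\<close> b0 by (intro mult_right_mono) auto
    \<comment> \<open>The threshold of the lemma is chosen for this sum: (2/k - k\<epsilon>) + (k -
      2)(1/k + \<epsilon>) = 1 - 2\<epsilon>.\<close>
    also have "(real k - 2) * b = m - 2 / real k * m + (real k - 2) * \<epsilon> * m"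
      using \<open>k \<ge> 2\<close> by (simp add: b_def field_simps)
    finally have "real (card (\<Union>x\<in>T. nonnbrs S x)) \<le> m - 2 * \<epsilon> * m"
      using small by (simp add: algebra_simps)
    then show "2 * \<epsilon> * m \<le> real (card (common_nbrs S T))"
      using card_common_nbrs[OF fin, of T] by (simp add: m_def)
  qed (use \<open>k \<ge> 2\<close> \<open>0 < \<epsilon>\<close> in \<open>auto simp: m_def\<close>)
  moreover have "k - 1 + 2 = k + 1" using \<open>k \<ge> 2\<close> by simp
  ultimately show False using few by (simp add: m_def)
qed

text \<open>Fix a \<open>k\<close>-clique \<open>C\<close>. The sets \<open>nonnbrs S v\<close>, \<open>v \<in> C\<close>, nearly partition \<open>S\<close>; a vertex
  with a neighbour in \<open>common_nbrs S (C - {v})\<close> for every \<open>v \<in> C\<close> would have almost no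
  non-neighbours. Hence each vertex misses one of these sets entirely, and this choice
  is the colouring.\<close>

lemma multipartite_if_few_joints:
  assumes fin: "finite S" "S \<noteq> {}" and "k \<ge> 3" and \<epsilon>: "\<epsilon> = 1 / (20 * real k ^ 5)"
    and deg: "\<And>v. v \<in> S \<Longrightarrow> (1 - 1 / real k - \<epsilon>) * real (card S) < real (card (nbrs S v))"
    and few: "\<And>u v. u \<in> S \<Longrightarrow> v \<in> S \<Longrightarrow> E u v \<Longrightarrow>
      real (card {T \<in> cliques_in S (k + 1). u \<in> T \<and> v \<in> T})
        < (2 * \<epsilon> * real (card S) / real k) ^ (k - 1)"
  obtains f :: "'a \<Rightarrow> nat" where "\<And>u. u \<in> S \<Longrightarrow> f u < k" "\<And>u v. u \<in> S \<Longrightarrow> v \<in> S \<Longrightarrow> E u v \<Longrightarrow> f u \<noteq> f v"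
proof -
  define m where "m = real (card S)"
  define A where "A = nonnbrs S"
  \<comment> \<open>Both constants come from the union bound for adjacent vertices: subtracting one
    upper bound (1/k + \<epsilon>)m from (2/k - k\<epsilon>)m gives the lower bound \<open>L\<close>
    for one set, and subtracting (2/k - k\<epsilon>)m from two upper bounds gives the overlap
    \<open>\<eta>\<close>.\<close>
  define L where "L = (1 / real k - (real k + 1) * \<epsilon>) * m"
  define \<eta> where "\<eta> = (real k + 2) * \<epsilon> * m"
  have m: "m > 0" using fin by (simp add: m_def card_gt_0_iff)
  have k: "real k \<ge> 3" using \<open>k \<ge> 3\<close> by simp
  have \<epsilon>0: "\<epsilon> > 0" using k by (simp add: \<epsilon>)
  have \<eta>0: "\<eta> > 0" using k m \<epsilon>0 by (simp add: \<eta>_def)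
  have e5: "20 * real k ^ 5 * \<epsilon> = 1" using k by (simp add: \<epsilon>)
  have finA [simp]: "finite (A v)" for v using fin by (simp add: A_def)
  have A_ub: "real (card (A v)) \<le> (1 / real k + \<epsilon>) * m" if "v \<in> S" for v
    using deg[OF that] card_nonnbrs[OF fin(1), of v] by (simp add: A_def m_def algebra_simps)
  have Un: "(2 / real k - real k * \<epsilon>) * m < real (card (A u \<union> A v))"
    if "u \<in> S" "v \<in> S" "E u v" for u v
    unfolding A_def m_def
    using that A_ub \<epsilon>0 k few by (intro card_nonnbrs_Un_gt fin) (auto simp: A_def m_def)
  have A_Int: "real (card (A u \<inter> A v)) \<le> \<eta>" if "u \<in> S" "v \<in> S" "E u v" for u v
  proof -
    have "real (card (A u)) + real (card (A v)) = real (card (A u \<union> A v)) + real (card (A u \<inter> A v))"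
      using card_Un_Int[OF finA finA] by (simp flip: of_nat_add)
    then show ?thesis using Un[OF that] A_ub[OF that(1)] A_ub[OF that(2)]
      by (simp add: \<eta>_def algebra_simps)
  qed
  have small_deg: "1 / real k + \<epsilon> < 1 / (real k - 1)"
  proof -
    have "real k * (real k - 1) * \<epsilon> \<le> real k ^ 2 * \<epsilon>"
      using k \<epsilon>0 by (intro mult_right_mono) (auto simp: power2_eq_square)
    also have "\<dots> \<le> real k ^ 5 * \<epsilon>"
      using k \<epsilon>0 by (intro mult_right_mono power_increasing) auto
    also have "\<dots> < 1" using e5 by linarith
    finally show ?thesis using k by (simp add: field_simps)
  qed
  \<comment> \<open>The union bound speaks of adjacent pairs only, so a neighbour of
    \<open>u\<close> has to be produced first.\<close>
  have A_lb: "L \<le> real (card (A u))" if "u \<in> S" for u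
  proof -
    have "1 / (real k - 1) \<le> 1" using k by simp
    then have "1 / real k + \<epsilon> < 1" using small_deg by linarith
    then have "(1 / real k + \<epsilon>) * m < 1 * m" using m by (intro mult_strict_right_mono)
    then have "card (nbrs S u) > 0" 
      using A_ub[OF that] card_nonnbrs[OF fin(1), of u] by (simp add: A_def m_def)
    then obtain v where v: "v \<in> S" "E u v" by (auto simp: nbrs_def card_gt_0_iff)
    have "real (card (A u \<union> A v)) \<le> real (card (A u)) + real (card (A v))"
      by (metis card_Un_le of_nat_add of_nat_le_iff)
    moreover have "2 / real k * m = 2 * (1 / real k * m)" by simp
    ultimately show ?thesis using Un[OF that v] A_ub[OF v(1)]
      unfolding L_def left_diff_distrib distrib_right mult_1_left by linarith
  qed
  have "cliques_in S k \<noteq> {}"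
  proof (rule ex_clique[OF fin(1), of "(1 / real k + \<epsilon>) * m" k])
    have "(real k - 1) * (1 / real k + \<epsilon>) < (real k - 1) * (1 / (real k - 1))"
      using small_deg k by (intro mult_strict_left_mono) auto
    then have "(real k - 1) * (1 / real k + \<epsilon>) * m < 1 * m"
      using k m by (intro mult_strict_right_mono) auto
    then show "real (k - 1) * ((1 / real k + \<epsilon>) * m) < real (card S)"
      using \<open>k \<ge> 3\<close> by (simp add: of_nat_diff m_def mult.assoc)
  qed (use A_ub m \<epsilon>0 in \<open>auto simp: A_def\<close>)
  then obtain C where C: "C \<subseteq> S" "card C = k" "\<And>u v. u \<in> C \<Longrightarrow> v \<in> C \<Longrightarrow> u \<noteq> v \<Longrightarrow> E u v"
    by (auto simp: cliques_in_def)
  have CS: "v \<in> S" if "v \<in> C" for v using C(1) that by auto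
  have finC: "finite C" by (rule finite_subset[OF C(1) fin(1)])
  define W where "W v = common_nbrs S (C - {v})" for v
  define R where "R = S - (\<Union>v\<in>C. A v)"
  define rest where "rest = real (card R)"
  have rest: "rest \<le> real k * (real k + 1) * \<epsilon> * m + real k ^ 2 * \<eta>"
  proof -
    have "real (card C) * L - real (card C) ^ 2 * \<eta> \<le> real (card (\<Union>v\<in>C. A v))"
      by (rule card_UN_ge_of_small_overlap[OF finC finA])
        (use A_lb A_Int CS C(3) \<eta>0 in \<open>simp_all add: less_imp_le\<close>)
    moreover have "real (card C) * L = m - real k * (real k + 1) * \<epsilon> * m"
      using k unfolding C(2) by (simp add: L_def field_simps)
    moreover have "real (card R) = m - real (card (\<Union>v\<in>C. A v))"
    proof -
      have "(\<Union>v\<in>C. A v) \<subseteq> S" by (auto simp: A_def nonnbrs_def)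
      then show ?thesis using fin finC
        by (simp add: R_def m_def card_Diff_subset card_mono of_nat_diff)
    qed
    ultimately show ?thesis using C(2) by (simp add: rest_def)
  qed
  have cover: "real (card (A x)) \<le> rest + (\<Sum>v\<in>C. real (card (A x \<inter> A v)))" for x
  proof -
    have "A x \<subseteq> R \<union> (\<Union>v\<in>C. A x \<inter> A v)" by (auto simp: R_def A_def nonnbrs_def)
    then have "card (A x) \<le> card (R \<union> (\<Union>v\<in>C. A x \<inter> A v))"
      using fin finC by (intro card_mono) (auto simp: R_def)
    also have "\<dots> \<le> card R + card (\<Union>v\<in>C. A x \<inter> A v)" by (rule card_Un_le)
    also have "card (\<Union>v\<in>C. A x \<inter> A v) \<le> (\<Sum>v\<in>C. card (A x \<inter> A v))"
      by (rule card_UN_le[OF finC])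
    finally show ?thesis by (simp add: rest_def flip: of_nat_sum of_nat_add)
  qed
  have mk: "m / real k = 20 * real k ^ 4 * (\<epsilon> * m)"
    using e5 k by (simp add: field_simps eval_nat_numeral)
  have bound: "(real k + 1) * rest + real k * (real k + 1) * \<eta> < L"
  proof -
    \<comment> \<open>With \<open>rest\<close> and \<open>\<eta>\<close> expressed through
      \<open>\<epsilon> * m\<close>, and the deficit of \<open>L\<close> against m/k moved to the
      left, the claim becomes this polynomial in k being below 20 k^4; the factor 20 in \<epsilon>
      leaves room for the estimate 18 k^4.\<close>
    have "(real k + 1) * (real k ^ 3 + 4 * real k ^ 2 + 3 * real k + 1) \<le> (2 * real k) * (9 * real k ^ 3)"
    proof (intro mult_mono)
      have "real k ^ 2 \<le> real k ^ 3" "real k ^ 1 \<le> real k ^ 3"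
        by (rule power_increasing; use k in simp)+
      moreover have "1 \<le> real k ^ 3" using k by (intro one_le_power) simp
      ultimately show "real k ^ 3 + 4 * real k ^ 2 + 3 * real k + 1 \<le> 9 * real k ^ 3"
        unfolding power_one_right by linarith
    qed (use k in auto)
    also have "\<dots> < 20 * real k ^ 4" using k by (simp add: eval_nat_numeral)
    finally have "(real k + 1) * (real k ^ 3 + 4 * real k ^ 2 + 3 * real k + 1) * (\<epsilon> * m) < m / real k"
      unfolding mk using \<epsilon>0 m by (intro mult_strict_right_mono) auto
    moreover have "(real k + 1) * rest \<le> (real k + 1) * (real k * (real k + 1) * \<epsilon> * m + real k ^ 2 * \<eta>)"
      using rest k by (intro mult_left_mono) auto
    ultimately show ?thesis
      by (simp add: L_def \<eta>_def algebra_simps eval_nat_numeral)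
  qed
  have W_miss: "\<exists>v\<in>C. W v \<subseteq> A u" if u: "u \<in> S" for u
  proof (rule ccontr)
    assume "\<not> ?thesis"
    then have "\<forall>v\<in>C. \<exists>w. w \<in> W v \<and> w \<notin> A u" by blast
    then obtain w where w: "\<And>v. v \<in> C \<Longrightarrow> w v \<in> W v" "\<And>v. v \<in> C \<Longrightarrow> w v \<notin> A u"
      by metis
    \<comment> \<open>The vertex \<open>w v\<close> is adjacent to all of \<open>C - {v}\<close>, so
      \<open>A (w v)\<close> hardly meets the other sets and must fill almost all of
      \<open>A v\<close>. As \<open>u\<close> is adjacent to \<open>w v\<close>, \<open>A u\<close>
      hardly meets \<open>A (w v)\<close>, hence hardly meets \<open>A v\<close>. If this happens
      for every \<open>v \<in> C\<close>, almost nothing is left for \<open>A u\<close>.\<close>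
    have "real (card (A u \<inter> A v)) \<le> \<eta> + (rest + real k * \<eta>)" if v: "v \<in> C" for v
    proof -
      have wS: "w v \<in> S" using w(1)[OF v] by (auto simp: W_def common_nbrs_def)
      have "E u (w v)" using w(2)[OF v] wS by (auto simp: A_def nonnbrs_def)
      then have uw: "real (card (A u \<inter> A (w v))) \<le> \<eta>" using A_Int u wS by blast
      have "(\<Sum>x\<in>C. real (card (A (w v) \<inter> A x))) =
          real (card (A (w v) \<inter> A v)) + (\<Sum>x\<in>C - {v}. real (card (A (w v) \<inter> A x)))"
        using finC v by (simp add: sum.remove)
      also have "(\<Sum>x\<in>C - {v}. real (card (A (w v) \<inter> A x))) \<le> real (card (C - {v})) * \<eta>"
      proof (rule sum_bounded_above)
        fix x assume x: "x \<in> C - {v}"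
        then have "E (w v) x" using w(1)[OF v] sym by (auto simp: W_def common_nbrs_def)
        then show "real (card (A (w v) \<inter> A x)) \<le> \<eta>" using A_Int wS x CS by blast
      qed
      also have "real (card (C - {v})) = real k - 1"
        using v finC C(2) \<open>k \<ge> 3\<close> by (simp add: of_nat_diff)
      finally have "L \<le> rest + real (card (A (w v) \<inter> A v)) + (real k - 1) * \<eta>"
        using cover[of "w v"] A_lb[OF wS] by linarith
      moreover have "card (A u \<inter> A v) \<le> card (A u \<inter> A (w v)) + card (A v - A (w v))"
        by (rule order.trans[OF card_mono card_Un_le]) auto
      moreover have "real (card (A v - A (w v))) = real (card (A v)) - real (card (A (w v) \<inter> A v))"
        by (subst card_Diff_subset_Int) (auto simp: of_nat_diff card_mono Int_commute)
      moreover have "real (card (A v)) \<le> (1 / real k + \<epsilon>) * m" using A_ub CS[OF v] by blast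
      ultimately show ?thesis using uw by (simp add: L_def \<eta>_def algebra_simps)
    qed
    then have "(\<Sum>v\<in>C. real (card (A u \<inter> A v))) \<le> real (card C) * (\<eta> + (rest + real k * \<eta>))"
      by (rule sum_bounded_above)
    then have "L \<le> rest + real k * (\<eta> + (rest + real k * \<eta>))"
      using cover[of u] A_lb[OF u] unfolding C(2) by linarith
    then show False using bound by (simp add: algebra_simps)
  qed
  then obtain g where g: "\<And>u. u \<in> S \<Longrightarrow> g u \<in> C \<and> W (g u) \<subseteq> A u" by metis
  have gE: "g u \<noteq> g v" if uv: "u \<in> S" "v \<in> S" "E u v" for u v
  proof
    assume eq: "g u = g v"
    \<comment> \<open>Equal colours put \<open>W (g u)\<close> inside
      \<open>A u \<inter> A v\<close>. But \<open>W (g u)\<close> is the common neighbourhood of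
      only k - 1 vertices and has about m/k elements, far more than the overlap
      \<open>\<eta>\<close> allowed for adjacent vertices.\<close>
    have "real (card (\<Union>x\<in>C - {g u}. nonnbrs S x)) \<le> real (card (C - {g u})) * ((1 / real k + \<epsilon>) * m)"
      using A_ub CS finC by (intro card_UN_nonnbrs_le) (auto simp: A_def)
    moreover have "real (card (C - {g u})) = real k - 1"
      using g[OF uv(1)] finC C(2) \<open>k \<ge> 3\<close> by (simp add: of_nat_diff)
    ultimately have "m - (real k - 1) * ((1 / real k + \<epsilon>) * m) \<le> real (card (W (g u)))"
      using card_common_nbrs[OF fin(1), of "C - {g u}"] by (simp add: W_def m_def)
    also have "card (W (g u)) \<le> card (A u \<inter> A v)"
      using g[OF uv(1)] g[OF uv(2)] eq by (intro card_mono) auto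
    also have "real (card (A u \<inter> A v)) \<le> \<eta>" by (rule A_Int[OF uv])
    finally have "m - (real k - 1) * ((1 / real k + \<epsilon>) * m) \<le> \<eta>" by simp
    moreover have "m - (real k - 1) * ((1 / real k + \<epsilon>) * m) = m / real k - (real k - 1) * (\<epsilon> * m)"
      using k by (simp add: field_simps)
    ultimately have "m / real k \<le> \<eta> + (real k - 1) * (\<epsilon> * m)" by linarith
    then have "20 * real k ^ 4 * (\<epsilon> * m) \<le> (2 * real k + 1) * (\<epsilon> * m)"
      unfolding mk by (simp add: \<eta>_def algebra_simps)
    then have "20 * real k ^ 4 \<le> 2 * real k + 1" using \<epsilon>0 m by simp
    moreover have "real k ^ 1 \<le> real k ^ 4" by (rule power_increasing) (use k in simp_all)
    ultimately show False using k unfolding power_one_right by linarith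
  qed
  obtain h where h: "bij_betw h C {..<k}"
    using finC C(2) by (metis atLeast0LessThan ex_bij_betw_finite_nat)
  show thesis
  proof (rule that[of "h \<circ> g"])
    show "(h \<circ> g) u < k" if "u \<in> S" for u
      using g[OF that] h by (auto simp: bij_betw_def)
    show "(h \<circ> g) u \<noteq> (h \<circ> g) v" if "u \<in> S" "v \<in> S" "E u v" for u v
      using g[OF that(1)] g[OF that(2)] gE[OF that] h by (auto simp: bij_betw_def inj_on_def)
  qed
qed

end

section \<open>The largest eigenvalue as the maximum of a quadratic form\<close>

context ugraph
begin

text \<open>The entry at \<open>i\<close> of Qx for the subgraph induced on \<open>S\<close>, with
  the degree term distributed over the neighbours. Keeping \<open>S\<close> as a parameter lets
  deletion shrink a set, without relabelling vertices.\<close>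

definition sl :: "'a set \<Rightarrow> ('a \<Rightarrow> real) \<Rightarrow> 'a \<Rightarrow> real" where
  "sl S x i = (\<Sum>j\<in>nbrs S i. x i + x j)"

definition qform :: "'a set \<Rightarrow> ('a \<Rightarrow> real) \<Rightarrow> real" where
  "qform S x = (\<Sum>i\<in>S. x i * sl S x i)"

definition qmax :: "'a set \<Rightarrow> real" where
  "qmax S = (SUP x\<in>{x. (\<Sum>i\<in>S. (x i)\<^sup>2) = 1}. qform S x)"

lemma sum_nbrs: "finite S \<Longrightarrow> (\<Sum>j\<in>nbrs S i. f j) = (\<Sum>j\<in>S. if E i j then f j else 0)"
  for f :: "'a \<Rightarrow> real"
  unfolding nbrs_def by (subst sum.inter_filter) auto

lemma sum_nbrs_swap:
  fixes f :: "'a \<Rightarrow> 'a \<Rightarrow> real"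
  assumes "finite S"
  shows "(\<Sum>i\<in>S. \<Sum>j\<in>nbrs S i. f i j) = (\<Sum>i\<in>S. \<Sum>j\<in>nbrs S i. f j i)"
proof -
  have E_sym: "E i j = E j i" for i j using sym by blast
  have "(\<Sum>i\<in>S. \<Sum>j\<in>nbrs S i. f i j) = (\<Sum>i\<in>S. \<Sum>j\<in>S. if E i j then f i j else 0)"
    using assms by (simp add: sum_nbrs)
  also have "\<dots> = (\<Sum>i\<in>S. \<Sum>j\<in>S. if E j i then f j i else 0)"
    by (rule sum.swap)
  also have "\<dots> = (\<Sum>i\<in>S. \<Sum>j\<in>nbrs S i. f j i)"
    using assms by (simp add: sum_nbrs E_sym)
  finally show ?thesis .
qed

lemma sl_add: "sl S (\<lambda>i. x i + t * z i) i = sl S x i + t * sl S z i"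
  by (simp add: sl_def sum.distrib sum_distrib_left algebra_simps)

lemma sl_cong: "i \<in> S \<Longrightarrow> (\<And>j. j \<in> S \<Longrightarrow> x j = y j) \<Longrightarrow> sl S x i = sl S y i"
  by (auto simp: sl_def nbrs_def intro!: sum.cong)

lemma qform_cong: "(\<And>j. j \<in> S \<Longrightarrow> x j = y j) \<Longrightarrow> qform S x = qform S y"
  unfolding qform_def by (intro sum.cong) (auto intro!: sl_cong arg_cong2[of _ _ _ _ "(*)"])

lemma sl_symmetric:
  assumes "finite S"
  shows "(\<Sum>i\<in>S. z i * sl S x i) = (\<Sum>i\<in>S. x i * sl S z i)"
proof -
  have "(\<Sum>i\<in>S. \<Sum>j\<in>nbrs S i. z i * x j) = (\<Sum>i\<in>S. \<Sum>j\<in>nbrs S i. z j * x i)"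
    by (rule sum_nbrs_swap[OF assms])
  then show ?thesis
    by (simp add: sl_def sum_distrib_left algebra_simps sum.distrib del: sum_constant)
qed

lemma qform_add:
  assumes "finite S"
  shows "qform S (\<lambda>i. x i + t * z i) = qform S x + 2 * t * (\<Sum>i\<in>S. z i * sl S x i) + t\<^sup>2 * qform S z"
proof -
  have "qform S (\<lambda>i. x i + t * z i) = qform S x + t * (\<Sum>i\<in>S. z i * sl S x i)
      + t * (\<Sum>i\<in>S. x i * sl S z i) + t\<^sup>2 * qform S z"
    by (simp add: qform_def sl_add sum.distrib sum_distrib_left algebra_simps power2_eq_square)
  then show ?thesis using sl_symmetric[OF assms, of z x] by simp
qed

lemma qform_scale: "qform S (\<lambda>i. c * x i) = c\<^sup>2 * qform S x"
  by (simp add: qform_def sl_def sum_distrib_left algebra_simps power2_eq_square)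

lemma qform_abs: "qform S x \<le> qform S (\<lambda>i. \<bar>x i\<bar>)"
  unfolding qform_def sl_def sum_distrib_left
proof (intro sum_mono)
  fix i j
  have "x i * x j \<le> \<bar>x i\<bar> * \<bar>x j\<bar>" by (metis abs_ge_self abs_mult)
  then show "x i * (x i + x j) \<le> \<bar>x i\<bar> * (\<bar>x i\<bar> + \<bar>x j\<bar>)"
    by (simp add: algebra_simps)
qed

lemma qform_max_exists:
  assumes fin: "finite S" "S \<noteq> {}"
  obtains x where "(\<Sum>i\<in>S. (x i)\<^sup>2) = 1" "\<And>y. qform S y \<le> qform S x * (\<Sum>i\<in>S. (y i)\<^sup>2)"
proof -
  \<comment> \<open>Coordinates outside \<open>S\<close> are pinned to 0, so that this product of
    compact sets contains the unit sphere of the coordinates in \<open>S\<close>, and a maximum is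
    attained within the plain function type.\<close>
  define P where "P = PiE UNIV (\<lambda>i. if i \<in> S then {-1..1::real} else {0})"
  define K where "K = P \<inter> {x. (\<Sum>i\<in>S. (x i)\<^sup>2) = 1}"
  have "compactin (product_topology (\<lambda>i. euclidean) UNIV) P"
    unfolding P_def compactin_PiE by auto
  then have "compact P" by (simp add: euclidean_product_topology)
  moreover have "closed {x :: 'a \<Rightarrow> real. (\<Sum>i\<in>S. (x i)\<^sup>2) = 1}"
    by (intro closed_Collect_eq continuous_intros) auto
  ultimately have "compact K" unfolding K_def by (rule compact_Int_closed)
  have normed: "\<exists>z\<in>K. \<forall>i\<in>S. z i = y i / sqrt (\<Sum>i\<in>S. (y i)\<^sup>2)" if "(\<Sum>i\<in>S. (y i)\<^sup>2) > 0" for y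
  proof -
    define s where "s = (\<Sum>i\<in>S. (y i)\<^sup>2)"
    define z where "z = (\<lambda>i. if i \<in> S then y i / sqrt s else 0)"
    have s: "s > 0" using that by (simp add: s_def)
    have "(\<Sum>i\<in>S. (z i)\<^sup>2) = s / s"
      using s by (simp add: z_def power_divide s_def flip: sum_divide_distrib)
    then have z1: "(\<Sum>i\<in>S. (z i)\<^sup>2) = 1" using s by simp
    have zb: "-1 \<le> z i \<and> z i \<le> 1" if "i \<in> S" for i
    proof -
      have "(z i)\<^sup>2 \<le> (\<Sum>i\<in>S. (z i)\<^sup>2)" using fin that by (intro member_le_sum) auto
      then have "\<bar>z i\<bar> \<le> 1" using z1 by (simp add: abs_square_le_1)
      then show ?thesis by linarith
    qed
    have "z i = 0" if "i \<notin> S" for i using that by (simp add: z_def)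
    then have "z \<in> P" using zb by (auto simp: P_def)
    then have "z \<in> K" using z1 by (simp add: K_def)
    then show ?thesis by (intro bexI[of _ z]) (auto simp: z_def s_def)
  qed
  have "(\<Sum>i\<in>S. (1::real)\<^sup>2) > 0" using fin by (simp add: card_gt_0_iff)
  then have "K \<noteq> {}" using normed[of "\<lambda>_. 1"] by auto
  have "continuous_on K (qform S)"
    unfolding qform_def sl_def by (intro continuous_intros) (auto intro!: continuous_on_subset[OF continuous_on_product_coordinates])
  then obtain x where x: "x \<in> K" "\<And>z. z \<in> K \<Longrightarrow> qform S z \<le> qform S x"
    using continuous_attains_sup[OF \<open>compact K\<close> \<open>K \<noteq> {}\<close>] by blast
  show thesis
  proof (rule that)
    show "(\<Sum>i\<in>S. (x i)\<^sup>2) = 1" using x by (simp add: K_def)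
    fix y :: "'a \<Rightarrow> real"
    define s where "s = (\<Sum>i\<in>S. (y i)\<^sup>2)"
    show "qform S y \<le> qform S x * (\<Sum>i\<in>S. (y i)\<^sup>2)"
    proof (cases "s > 0")
      case True
      then obtain z where z: "z \<in> K" "\<forall>i\<in>S. z i = y i / sqrt s" using normed[of y] by (auto simp: s_def)
      have "qform S z = qform S (\<lambda>i. (1 / sqrt s) * y i)" using z by (intro qform_cong) auto
      also have "\<dots> = qform S y / s" using True unfolding qform_scale by (simp add: power_divide)
      finally have "qform S y / s \<le> qform S x" using x(2)[OF z(1)] by simp
      then show ?thesis using True by (simp add: s_def divide_le_eq)
    next
      case False
      moreover have "s \<ge> 0" by (simp add: s_def sum_nonneg)
      ultimately have "s = 0" by simp
      then have "\<forall>i\<in>S. y i = 0" using fin by (simp add: s_def sum_nonneg_eq_0_iff)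
      then show ?thesis by (simp add: qform_def)
    qed
  qed
qed

lemma qmax_eq:
  assumes "(\<Sum>i\<in>S. (x i)\<^sup>2) = 1" "\<And>y. qform S y \<le> qform S x * (\<Sum>i\<in>S. (y i)\<^sup>2)"
  shows "qmax S = qform S x"
  unfolding qmax_def
proof (rule cSup_eq_maximum)
  show "qform S x \<in> qform S ` {x. (\<Sum>i\<in>S. (x i)\<^sup>2) = 1}" using assms by auto
  fix r assume "r \<in> qform S ` {x. (\<Sum>i\<in>S. (x i)\<^sup>2) = 1}"
  then obtain y where "(\<Sum>i\<in>S. (y i)\<^sup>2) = 1" "r = qform S y" by auto
  then show "r \<le> qform S x" using assms(2)[of y] by simp
qed

lemma qform_le_qmax:
  assumes "finite S" "S \<noteq> {}"
  shows "qform S y \<le> qmax S * (\<Sum>i\<in>S. (y i)\<^sup>2)"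
  using qform_max_exists[OF assms] qmax_eq by metis

text \<open>First-order optimality without derivatives: at t = -b/d with d > c the right-hand side
  is (b/d)^2 (c - d), negative unless b = 0.\<close>

lemma linear_coeff_zero:
  fixes b c :: real
  assumes "\<And>t. 0 \<le> t * b + t\<^sup>2 * c"
  shows "b = 0"
proof (rule ccontr)
  assume "b \<noteq> 0"
  define d where "d = \<bar>c\<bar> + 1"
  have d: "d > 0" "c < d" by (auto simp: d_def)
  have "0 \<le> (- b / d) * b + (- b / d)\<^sup>2 * c" by (rule assms)
  also have "\<dots> = (b / d)\<^sup>2 * (c - d)" using d by (simp add: field_simps power2_eq_square)
  also have "\<dots> < 0" using d \<open>b \<noteq> 0\<close> by (intro mult_pos_neg) auto
  finally show False by simp
qed

text \<open>Absolute values do not decrease the form, so a maximiser may be taken nonnegative;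
  optimality then makes it an eigenvector. Strict positivity is not claimed, as the graph may be
  disconnected.\<close>

lemma perron:
  assumes fin: "finite S" "S \<noteq> {}"
  obtains x where "\<And>i. 0 \<le> x i" "(\<Sum>i\<in>S. (x i)\<^sup>2) = 1" "\<And>i. i \<in> S \<Longrightarrow> sl S x i = qmax S * x i"
proof -
  obtain x0 where x0: "(\<Sum>i\<in>S. (x0 i)\<^sup>2) = 1" "\<And>y. qform S y \<le> qform S x0 * (\<Sum>i\<in>S. (y i)\<^sup>2)"
    using qform_max_exists[OF fin] by blast
  define x where "x i = \<bar>x0 i\<bar>" for i
  define \<rho> where "\<rho> = qmax S"
  have x1: "(\<Sum>i\<in>S. (x i)\<^sup>2) = 1" using x0 by (simp add: x_def)
  have "qform S x \<le> qmax S" using qform_le_qmax[OF fin, of x] x1 by simp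
  moreover have "qmax S \<le> qform S x"
    using qform_abs[of S x0] qmax_eq[OF x0] unfolding x_def[abs_def] by simp
  ultimately have qx: "qform S x = \<rho>" by (simp add: \<rho>_def)
  \<comment> \<open>Perturbing in the direction of the residual makes the linear term of the
    optimality condition equal to twice the squared norm of the residual, which must therefore
    vanish.\<close>
  define z where "z i = \<rho> * x i - sl S x i" for i
  have "2 * (\<Sum>i\<in>S. (z i)\<^sup>2) = 0"
  proof (rule linear_coeff_zero)
    fix t
    have "qform S (\<lambda>i. x i + t * z i) \<le> \<rho> * (\<Sum>i\<in>S. (x i + t * z i)\<^sup>2)"
      using qform_le_qmax[OF fin] by (simp add: \<rho>_def)
    moreover have "(\<Sum>i\<in>S. (x i + t * z i)\<^sup>2) =
        (\<Sum>i\<in>S. (x i)\<^sup>2) + 2 * t * (\<Sum>i\<in>S. z i * x i) + t\<^sup>2 * (\<Sum>i\<in>S. (z i)\<^sup>2)"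
      by (simp add: power2_sum sum.distrib sum_distrib_left power_mult_distrib algebra_simps)
    moreover have "(\<Sum>i\<in>S. z i * sl S x i) = \<rho> * (\<Sum>i\<in>S. z i * x i) - (\<Sum>i\<in>S. (z i)\<^sup>2)"
      by (simp add: z_def power2_eq_square sum_distrib_left algebra_simps flip: sum_subtractf)
    then have "2 * t * (\<Sum>i\<in>S. z i * sl S x i) =
        \<rho> * (2 * t * (\<Sum>i\<in>S. z i * x i)) - t * (2 * (\<Sum>i\<in>S. (z i)\<^sup>2))"
      by (simp add: right_diff_distrib)
    ultimately have "t\<^sup>2 * qform S z \<le> t * (2 * (\<Sum>i\<in>S. (z i)\<^sup>2)) + \<rho> * (t\<^sup>2 * (\<Sum>i\<in>S. (z i)\<^sup>2))"
      using qx x1 by (simp add: qform_add[OF fin(1)] distrib_left)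
    then show "0 \<le> t * (2 * (\<Sum>i\<in>S. (z i)\<^sup>2)) + t\<^sup>2 * (\<rho> * (\<Sum>i\<in>S. (z i)\<^sup>2) - qform S z)"
      by (simp add: algebra_simps)
  qed
  then have "\<forall>i\<in>S. z i = 0" using fin by (simp add: sum_nonneg_eq_0_iff)
  then have "\<And>i. i \<in> S \<Longrightarrow> sl S x i = qmax S * x i" by (simp add: z_def \<rho>_def)
  then show thesis using that[of x] x1 by (simp add: x_def)
qed

text \<open>Read the eigenvalue equation at a largest entry: each of at most
  \<open>card S - 1\<close> neighbours contributes at most twice that entry. This is the cap 2 on
  the ratio driving the deletion process.\<close>

lemma qmax_le:
  assumes fin: "finite S" "S \<noteq> {}"
  shows "qmax S \<le> 2 * (real (card S) - 1)"
proof -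
  obtain x where x: "\<And>i. 0 \<le> x i" "(\<Sum>i\<in>S. (x i)\<^sup>2) = 1" "\<And>i. i \<in> S \<Longrightarrow> sl S x i = qmax S * x i"
    using perron[OF fin] by blast
  have "Max (x ` S) \<in> x ` S" using fin by (intro Max_in) auto
  then obtain v where "v \<in> S" "x v = Max (x ` S)" by auto
  then have v: "v \<in> S" "\<And>i. i \<in> S \<Longrightarrow> x i \<le> x v" using fin by auto
  have xv: "x v > 0"
  proof (rule ccontr)
    assume "\<not> ?thesis"
    then have "\<forall>i\<in>S. x i = 0" using v x(1) by (metis order.antisym order.trans not_less)
    then show False using x(2) by simp
  qed
  have "nbrs S v \<subseteq> S - {v}" using irrefl by (auto simp: nbrs_def)
  then have "card (nbrs S v) \<le> card S - 1"
    using card_mono[of "S - {v}" "nbrs S v"] fin v by simp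
  moreover have "card S > 0" using fin by (simp add: card_gt_0_iff)
  ultimately have d: "real (card (nbrs S v)) \<le> real (card S) - 1" by linarith
  have "qmax S * x v = (\<Sum>j\<in>nbrs S v. x v + x j)" using x(3)[OF v(1)] by (simp add: sl_def)
  also have "\<dots> \<le> real (card (nbrs S v)) * (2 * x v)"
    using v by (intro sum_bounded_above) (auto simp: nbrs_def)
  also have "\<dots> \<le> (real (card S) - 1) * (2 * x v)" using d xv by (intro mult_right_mono) auto
  finally have "qmax S * x v \<le> (2 * (real (card S) - 1)) * x v" by (simp only: ac_simps)
  then show ?thesis by (rule mult_right_le_imp_le[OF _ xv])
qed

lemma average_degree_le_qmax:
  assumes "finite S" "S \<noteq> {}"
  shows "2 * (\<Sum>i\<in>S. real (card (nbrs S i))) \<le> qmax S * real (card S)"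
  using qform_le_qmax[OF assms, of "\<lambda>_. 1"] by (simp add: qform_def sl_def sum_distrib_left mult.commute)

end

section \<open>Identification of the quadratic form maximum with the largest matrix
  eigenvalue\<close>

lemma ugraph_graph: "graph n E \<Longrightarrow> ugraph E"
  by (unfold_locales) (auto simp: graph_def)

text \<open>Needed because \<open>q\<close> is a \<open>Max\<close>, which is meaningful only for a
  finite set.\<close>

lemma finite_eigenvalues: "finite (eigenvalues n M)"
proof (rule finite_subset)
  define A where "A = mat n n (\<lambda>(i, j). M i j)"
  have A: "A \<in> carrier_mat n n" by (simp add: A_def)
  show "finite (spectrum A)" by (rule card_finite_spectrum[OF A])
  show "eigenvalues n M \<subseteq> spectrum A"
  proof
    fix \<mu> assume "\<mu> \<in> eigenvalues n M"
    then obtain x where x: "\<exists>i<n. x i \<noteq> 0" "\<forall>i<n. (\<Sum>j<n. M i j * x j) = \<mu> * x i"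
      by (auto simp: eigenvalues_def)
    have "eigenvector A (vec n x) \<mu>"
      unfolding eigenvector_def
    proof (intro conjI)
      show "vec n x \<noteq> 0\<^sub>v (dim_row A)"
        using x(1) by (auto simp: A_def vec_eq_iff)
      show "A *\<^sub>v vec n x = \<mu> \<cdot>\<^sub>v vec n x"
        using x(2) by (intro eq_vecI) (auto simp: A_def scalar_prod_def atLeast0LessThan)
    qed (simp add: A_def)
    then show "\<mu> \<in> spectrum A" by (auto simp: spectrum_def eigenvalue_def)
  qed
qed

lemma q_eq_qmax:
  assumes "graph n E" "n > 0"
  shows "q n E = ugraph.qmax E {..<n}"
proof -
  interpret ugraph E using ugraph_graph[OF assms(1)] .
  have mult: "(\<Sum>j<n. signless_laplacian n E i j * x j) = sl {..<n} x i" if "i < n" for x i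
  proof -
    have "(\<Sum>j<n. signless_laplacian n E i j * x j) =
        (\<Sum>j<n. (if j = i then real (Defs.degree n E i) * x i else 0) + (if E i j then x j else 0))"
      by (intro sum.cong) (auto simp: signless_laplacian_def irrefl)
    also have "\<dots> = real (Defs.degree n E i) * x i + (\<Sum>j\<in>nbrs {..<n} i. x j)"
      using that by (simp add: sum.distrib sum_nbrs)
    also have "Defs.degree n E i = card (nbrs {..<n} i)"
      by (simp add: Defs.degree_def nbrs_def)
    finally show ?thesis by (simp add: sl_def sum.distrib)
  qed
  show ?thesis unfolding q_def
  proof (rule Max_eqI[OF finite_eigenvalues])
    have ne: "{..<n} \<noteq> {}" using assms by auto
    obtain x where x: "\<And>i. 0 \<le> x i" "(\<Sum>i<n. (x i)\<^sup>2) = 1" "\<And>i. i < n \<Longrightarrow> sl {..<n} x i = qmax {..<n} * x i"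
      using perron[OF _ ne] by auto
    have "\<exists>i<n. x i \<noteq> 0"
    proof (rule ccontr)
      assume "\<not> ?thesis"
      then have "(\<Sum>i<n. (x i)\<^sup>2) = 0" by simp
      then show False using x by simp
    qed
    then show "qmax {..<n} \<in> eigenvalues n (signless_laplacian n E)"
      using x mult by (auto simp: eigenvalues_def)
    fix \<mu> assume "\<mu> \<in> eigenvalues n (signless_laplacian n E)"
    then obtain y where y: "\<exists>i<n. y i \<noteq> 0" "\<And>i. i < n \<Longrightarrow> sl {..<n} y i = \<mu> * y i"
      by (auto simp: eigenvalues_def mult)
    obtain i where "i < n" "y i \<noteq> 0" using y(1) by blast
    then have "(\<Sum>i<n. (y i)\<^sup>2) > 0"
      by (intro sum_pos2[of "{..<n}" i]) auto
    moreover have "\<mu> * (\<Sum>i<n. (y i)\<^sup>2) = qform {..<n} y"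
      using y(2) by (simp add: qform_def sum_distrib_left power2_eq_square algebra_simps)
    moreover have "qform {..<n} y \<le> qmax {..<n} * (\<Sum>i<n. (y i)\<^sup>2)"
      using qform_le_qmax[OF _ ne] by simp
    ultimately show "\<mu> \<le> qmax {..<n}"
      by (metis mult_right_le_imp_le)
  qed
qed

section \<open>Deleting the vertex of least weight\<close>

text \<open>Here \<open>\<rho>\<close> and \<open>\<rho>'\<close> are the values of q before and
  after deletion, \<open>m\<close> is the order and \<open>\<xi>\<close> the square of the least
  entry. The average of the squares is 1/m, so \<open>\<beta> = 0\<close> is always available and
  gives monotonicity; a shortfall \<open>\<beta>\<close> of \<open>m * \<xi>\<close> below 1 becomes
  a gain proportional to \<open>\<rho> - m\<close>.\<close>

lemma rescaled_gain:
  fixes m \<rho> \<rho>' \<xi> \<beta> :: real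
  assumes "\<rho> - 1 - (2 * \<rho> - m) * \<xi> \<le> \<rho>' * (1 - \<xi>)" "0 \<le> \<xi>" "m * \<xi> \<le> 1 - \<beta>"
    and "0 \<le> \<beta>" "3 \<le> m" "m \<le> \<rho>"
  shows "\<rho> / (m - 1) + \<beta> * (\<rho> - m) / ((m - 1) * (m - 2)) \<le> \<rho>' / (m - 2)"
proof -
  have "m * \<xi> \<le> 1" using assms by linarith
  moreover have "3 * \<xi> \<le> m * \<xi>" using assms by (intro mult_right_mono) auto
  ultimately have \<xi>: "\<xi> < 1" by linarith
  \<comment> \<open>Three nonnegative terms whose sum is exactly the difference of the two sides
    after clearing denominators and multiplying by \<open>1 - \<xi>\<close>.\<close>
  have "0 \<le> (1 - \<beta> - m * \<xi>) * (\<rho> - m) + (1 - m * \<xi>) + \<xi> * \<beta> * (\<rho> - m)"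
    using assms \<open>m * \<xi> \<le> 1\<close> by simp
  also have "\<dots> = (m - 1) * (\<rho> - 1 - (2 * \<rho> - m) * \<xi>) - (\<rho> * (m - 2) + \<beta> * (\<rho> - m)) * (1 - \<xi>)"
    by (simp add: algebra_simps)
  finally have "(\<rho> * (m - 2) + \<beta> * (\<rho> - m)) * (1 - \<xi>) \<le> (m - 1) * (\<rho> - 1 - (2 * \<rho> - m) * \<xi>)"
    by simp
  also have "\<dots> \<le> (m - 1) * (\<rho>' * (1 - \<xi>))"
    using assms by (intro mult_left_mono) auto
  finally have "(\<rho> * (m - 2) + \<beta> * (\<rho> - m)) * (1 - \<xi>) \<le> ((m - 1) * \<rho>') * (1 - \<xi>)"
    by (simp only: mult.assoc)
  then have main: "\<rho> * (m - 2) + \<beta> * (\<rho> - m) \<le> (m - 1) * \<rho>'"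
    using \<xi> by (simp add: mult_le_cancel_right)
  have "\<rho> / (m - 1) + \<beta> * (\<rho> - m) / ((m - 1) * (m - 2)) =
      (\<rho> * (m - 2) + \<beta> * (\<rho> - m)) / ((m - 1) * (m - 2))"
    using assms by (simp add: add_divide_distrib)
  also have "\<dots> \<le> ((m - 1) * \<rho>') / ((m - 1) * (m - 2))"
    using main assms by (intro divide_right_mono) auto
  also have "\<dots> = \<rho>' / (m - 2)" using assms by simp
  finally show ?thesis .
qed

context ugraph
begin

text \<open>The form is the sum of (x i + x j)^2 over the edges, and deletion loses precisely the
  edges at \<open>w\<close>.\<close>

lemma qform_delete:
  assumes "finite S" "w \<in> S"
  shows "qform (S - {w}) x = qform S x - (\<Sum>j\<in>nbrs S w. (x w + x j)\<^sup>2)"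
proof -
  have sl: "sl (S - {w}) x i = sl S x i - (if E w i then x i + x w else 0)" if "i \<in> S" for i
  proof -
    have "nbrs S i = (if E w i then insert w (nbrs (S - {w}) i) else nbrs (S - {w}) i)"
      "w \<notin> nbrs (S - {w}) i"
      using sym assms by (auto simp: nbrs_def)
    then show ?thesis using assms by (simp add: sl_def algebra_simps)
  qed
  have "qform (S - {w}) x = (\<Sum>i\<in>S - {w}. x i * sl S x i) -
      (\<Sum>i\<in>S - {w}. if E w i then x i * (x i + x w) else 0)"
    unfolding qform_def sum_subtractf[symmetric] by (intro sum.cong) (auto simp: sl algebra_simps)
  also have "(\<Sum>i\<in>S - {w}. x i * sl S x i) = qform S x - (\<Sum>j\<in>nbrs S w. x w * (x w + x j))"
    using assms unfolding qform_def sum_distrib_left[symmetric] sl_def[symmetric] by (simp add: sum.remove)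
  also have "(\<Sum>i\<in>S - {w}. if E w i then x i * (x i + x w) else 0) = (\<Sum>j\<in>nbrs S w. x j * (x j + x w))"
    using assms irrefl by (simp add: sum_nbrs sum.remove)
  also have "qform S x - (\<Sum>j\<in>nbrs S w. x w * (x w + x j)) - (\<Sum>j\<in>nbrs S w. x j * (x j + x w)) =
      qform S x - (\<Sum>j\<in>nbrs S w. x w * (x w + x j) + x j * (x j + x w))"
    by (simp only: sum.distrib diff_diff_eq)
  also have "(\<Sum>j\<in>nbrs S w. x w * (x w + x j) + x j * (x j + x w)) = (\<Sum>j\<in>nbrs S w. (x w + x j)\<^sup>2)"
    by (intro sum.cong) (auto simp: algebra_simps power2_eq_square)
  finally show ?thesis .
qed

lemma sum_squares_nbrs_le:
  assumes "finite S" "(\<Sum>i\<in>S. (x i)\<^sup>2) = 1" "\<And>j. j \<in> S \<Longrightarrow> \<xi> \<le> (x j)\<^sup>2"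
  shows "(\<Sum>j\<in>nbrs S v. (x j)\<^sup>2) \<le> 1 - (real (card S) - real (card (nbrs S v))) * \<xi>"
proof -
  have "S = nbrs S v \<union> nonnbrs S v" "nbrs S v \<inter> nonnbrs S v = {}"
    by (auto simp: nbrs_def nonnbrs_def)
  then have "1 = (\<Sum>j\<in>nbrs S v. (x j)\<^sup>2) + (\<Sum>j\<in>nonnbrs S v. (x j)\<^sup>2)"
    using assms(1,2) by (metis sum.union_disjoint finite_nbrs finite_nonnbrs)
  moreover have "real (card (nonnbrs S v)) * \<xi> \<le> (\<Sum>j\<in>nonnbrs S v. (x j)\<^sup>2)"
    using assms(3) by (intro sum_bounded_below) (auto simp: nonnbrs_def)
  moreover have "real (card (nonnbrs S v)) = real (card S) - real (card (nbrs S v))"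
    using card_nonnbrs[OF assms(1), of v] by linarith
  ultimately show ?thesis by simp
qed

text \<open>The restriction of the eigenvector, of squared norm \<open>1 - (x w)\<^sup>2\<close>,
  serves as test vector for the smaller graph.\<close>

lemma qmax_delete:
  assumes fin: "finite S" "w \<in> S" "card S \<ge> 2" and x1: "(\<Sum>i\<in>S. (x i)\<^sup>2) = 1"
    and eig: "\<And>i. i \<in> S \<Longrightarrow> sl S x i = qmax S * x i"
    and min: "\<And>j. j \<in> S \<Longrightarrow> (x w)\<^sup>2 \<le> (x j)\<^sup>2"
  shows "qmax S - 1 - (2 * qmax S - real (card S)) * (x w)\<^sup>2 \<le> qmax (S - {w}) * (1 - (x w)\<^sup>2)"
proof -
  define d where "d = real (card (nbrs S w))"
  have "qform S x = (\<Sum>i\<in>S. qmax S * (x i)\<^sup>2)"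
    unfolding qform_def by (intro sum.cong) (auto simp: eig power2_eq_square)
  then have "qform S x = qmax S" using x1 by (simp flip: sum_distrib_left)
  \<comment> \<open>In this form the first summand adds up to 2 x w (Qx) w, which the eigenvalue
    equation evaluates, and the squares of the neighbours are bounded by the unit mass minus that of
    the non-neighbours.\<close>
  moreover have "(\<Sum>j\<in>nbrs S w. (x w + x j)\<^sup>2) = (\<Sum>j\<in>nbrs S w. 2 * x w * (x w + x j) - (x w)\<^sup>2 + (x j)\<^sup>2)"
    by (intro sum.cong) (auto simp: algebra_simps power2_eq_square)
  then have "(\<Sum>j\<in>nbrs S w. (x w + x j)\<^sup>2) = 2 * x w * sl S x w - d * (x w)\<^sup>2 + (\<Sum>j\<in>nbrs S w. (x j)\<^sup>2)"
    by (simp only: sl_def d_def sum.distrib[of "\<lambda>j. _ j - _ j"] sum_subtractf sum_distrib_left sum_constant)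
  then have "(\<Sum>j\<in>nbrs S w. (x w + x j)\<^sup>2) \<le> 2 * qmax S * (x w)\<^sup>2 - d * (x w)\<^sup>2 + (1 - (real (card S) - d) * (x w)\<^sup>2)"
    using sum_squares_nbrs_le[OF fin(1) x1 min, of w] eig[OF fin(2)]
    by (simp add: d_def power2_eq_square algebra_simps)
  moreover have "qform (S - {w}) x \<le> qmax (S - {w}) * (1 - (x w)\<^sup>2)"
  proof -
    have "S - {w} \<noteq> {}"
    proof
      assume "S - {w} = {}"
      then have "card S \<le> card {w}" by (intro card_mono) auto
      then show False using fin(3) by simp
    qed
    moreover have "(\<Sum>i\<in>S - {w}. (x i)\<^sup>2) = 1 - (x w)\<^sup>2"
      using x1 fin by (simp add: sum_diff1)
    ultimately show ?thesis using qform_le_qmax[of "S - {w}" x] fin by simp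
  qed
  ultimately show ?thesis using qform_delete[OF fin(1,2), of x] by (simp add: algebra_simps)
qed

text \<open>A vertex \<open>v\<close> of small degree forces the least entry of the Perron vector to be
  well below \<open>1 / sqrt (card S)\<close>, since the equation at \<open>v\<close> bounds its own entry.\<close>

lemma delete_step:
  assumes fin: "finite S" and m: "real (card S) \<ge> 8" "2 \<le> \<epsilon> * real (card S)"
    and \<epsilon>: "0 < \<epsilon>" "\<epsilon> \<le> 1" and c: "4 / 3 \<le> c" "c \<le> 2"
    and large: "c * (real (card S) - 1) \<le> qmax S"
    and v: "v \<in> S" "real (card (nbrs S v)) \<le> (c / 2 - \<epsilon>) * real (card S)"
  obtains w where "w \<in> S" "qmax S / (real (card S) - 1) + \<epsilon> / 12 / (real (card S) - 2)
      \<le> qmax (S - {w}) / (real (card S) - 2)"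
proof -
  define m where "m = real (card S)"
  define \<rho> where "\<rho> = qmax S"
  define d where "d = real (card (nbrs S v))"
  note m = m[folded m_def]
  have ne: "S \<noteq> {}" using v by auto
  obtain x where x: "\<And>i. 0 \<le> x i" "(\<Sum>i\<in>S. (x i)\<^sup>2) = 1" "\<And>i. i \<in> S \<Longrightarrow> sl S x i = qmax S * x i"
    using perron[OF fin ne] by blast
  have "Min (x ` S) \<in> x ` S" using fin ne by (intro Min_in) auto
  then obtain w where "w \<in> S" "x w = Min (x ` S)" by auto
  then have w: "w \<in> S" "\<And>i. i \<in> S \<Longrightarrow> x w \<le> x i" using fin by auto
  define \<xi> where "\<xi> = (x w)\<^sup>2"
  have min: "\<xi> \<le> (x j)\<^sup>2" if "j \<in> S" for j
    using w(2)[OF that] x(1) by (simp add: \<xi>_def power_mono)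
  have "4 / 3 * (m - 1) \<le> c * (m - 1)" using c m by (intro mult_right_mono) auto
  then have \<rho>: "4 / 3 * (m - 1) \<le> \<rho>" using large by (simp add: \<rho>_def m_def)
  have \<rho>m: "m \<le> \<rho>" using \<rho> m by (simp add: field_simps)
  \<comment> \<open>Square the eigenvalue equation at \<open>v\<close> in the form (\<rho> - d) x v
    = sum of the neighbours, apply Cauchy-Schwarz, and bound the neighbours' mass from above by
    letting every non-neighbour carry at least \<open>\<xi>\<close>.\<close>
  have "\<xi> * (\<rho> - d)\<^sup>2 \<le> (x v)\<^sup>2 * (\<rho> - d)\<^sup>2"
    using min[OF v(1)] by (intro mult_right_mono) auto
  also have "\<dots> = (\<Sum>j\<in>nbrs S v. x j)\<^sup>2"
  proof -
    have "(\<Sum>j\<in>nbrs S v. x j) = x v * (\<rho> - d)"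
      using x(3)[OF v(1)] by (simp add: sl_def sum.distrib d_def \<rho>_def algebra_simps)
    then show ?thesis by (simp add: power_mult_distrib)
  qed
  also have "\<dots> \<le> d * (\<Sum>j\<in>nbrs S v. (x j)\<^sup>2)"
    using Cauchy_Schwarz_ineq_sum[of "\<lambda>_. 1" x "nbrs S v"] by (simp add: d_def)
  also have "\<dots> \<le> d * (1 - (m - d) * \<xi>)"
    using sum_squares_nbrs_le[OF fin x(2) min, of v] by (intro mult_left_mono) (auto simp: d_def m_def)
  finally have "\<xi> * (\<rho> * (\<rho> - 2 * d) + d * m) \<le> d"
    by (simp add: power2_eq_square algebra_simps)
  define X where "X = \<rho> * (\<rho> - 2 * d)"
  have d_le: "2 * d \<le> c * m - 2 * \<epsilon> * m" using v(2) by (simp add: d_def m_def algebra_simps)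
  \<comment> \<open>The degree deficit yields 2\<epsilon>m - c; since c \<le> 2 \<le> \<epsilon>m,
    half of 2\<epsilon>m survives.\<close>
  have "\<epsilon> * m \<le> \<rho> - 2 * d"
    using d_le large c m by (simp add: \<rho>_def m_def algebra_simps)
  then have X: "m * (\<epsilon> * m) \<le> X"
    unfolding X_def using \<rho>m m \<epsilon> by (intro mult_mono) auto
  have X0: "0 < X" using X m \<epsilon> by (smt (verit) mult_pos_pos)
  have dm: "0 \<le> d" "d \<le> m"
    using card_nonnbrs[OF fin, of v] by (auto simp: d_def m_def)
  have "m * \<xi> \<le> 1 - \<epsilon> / 2"
  proof -
    have "d * m * \<epsilon> \<le> m * m * \<epsilon>" using dm m \<epsilon> by (intro mult_right_mono) auto
    moreover have "\<epsilon> * X \<le> 1 * X" using X0 \<epsilon> by (intro mult_right_mono) auto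
    ultimately have "\<epsilon> / 2 * (X + d * m) \<le> X" using X by (simp add: algebra_simps)
    then have "m * d \<le> (1 - \<epsilon> / 2) * (X + d * m)" by (simp add: algebra_simps)
    moreover have "m * (\<xi> * (X + d * m)) \<le> m * d"
      using \<open>\<xi> * (\<rho> * (\<rho> - 2 * d) + d * m) \<le> d\<close> m unfolding X_def by (intro mult_left_mono) auto
    ultimately have "(m * \<xi>) * (X + d * m) \<le> (1 - \<epsilon> / 2) * (X + d * m)" by (simp only: mult.assoc)
    moreover have "0 < X + d * m" using X0 dm m by (simp add: add_pos_nonneg)
    ultimately show ?thesis by (rule mult_right_le_imp_le)
  qed
  moreover have "\<rho> - 1 - (2 * \<rho> - m) * \<xi> \<le> qmax (S - {w}) * (1 - \<xi>)"
    unfolding \<rho>_def m_def \<xi>_def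
    using m w x min by (intro qmax_delete fin) (auto simp: \<xi>_def m_def)
  ultimately have "\<rho> / (m - 1) + \<epsilon> / 2 * (\<rho> - m) / ((m - 1) * (m - 2)) \<le> qmax (S - {w}) / (m - 2)"
    using m \<epsilon> \<rho>m by (intro rescaled_gain) (auto simp: \<xi>_def)
  \<comment> \<open>The 12 is the product of the 2 in the shortfall \<epsilon>/2 and the 6 in \<rho>
    - m \<ge> (m - 1)/6, which follows from \<rho> \<ge> 4/3 (m - 1) and m \<ge> 8.\<close>
  moreover have "\<epsilon> / 12 / (m - 2) \<le> \<epsilon> / 2 * (\<rho> - m) / ((m - 1) * (m - 2))"
  proof -
    have "\<epsilon> / 2 * ((m - 1) / 6) \<le> \<epsilon> / 2 * (\<rho> - m)"
      using \<rho> m \<epsilon> by (intro mult_left_mono) auto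
    then have "\<epsilon> / 2 * ((m - 1) / 6) / ((m - 1) * (m - 2)) \<le> \<epsilon> / 2 * (\<rho> - m) / ((m - 1) * (m - 2))"
      using m by (intro divide_right_mono) auto
    moreover have "\<epsilon> / 2 * ((m - 1) / 6) / ((m - 1) * (m - 2)) = (m - 1) * (\<epsilon> / 12) / ((m - 1) * (m - 2))"
      by (simp add: mult.commute)
    then have "\<epsilon> / 2 * ((m - 1) / 6) / ((m - 1) * (m - 2)) = \<epsilon> / 12 / (m - 2)"
      using m by (simp only: nonzero_mult_divide_mult_cancel_left)
    ultimately show ?thesis by simp
  qed
  ultimately have "\<rho> / (m - 1) + \<epsilon> / 12 / (m - 2) \<le> qmax (S - {w}) / (m - 2)" by linarith
  then show thesis using that[OF w(1)] by (simp add: \<rho>_def m_def)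
qed

text \<open>A single gain \<epsilon>/12/(m - 2) dominates \<epsilon>/12 times the decrease of ln(m -
  1), so the gains telescope to a logarithm. The ratio only grows, hence the hypothesis that it is
  at least \<open>c\<close> survives each deletion. Below order \<open>M\<close> the deletion step
  is no longer available, which is why the conclusion is an alternative.\<close>

lemma ex_large_min_degree_subset:
  assumes "finite S" and M: "8 \<le> M" "2 \<le> \<epsilon> * M" and "M \<le> real (card S)"
    and \<epsilon>: "0 < \<epsilon>" "\<epsilon> \<le> 1" and c: "4 / 3 \<le> c" "c \<le> 2"
    and "c \<le> qmax S / (real (card S) - 1)"
  shows "\<exists>T\<subseteq>S. 2 \<le> card T \<and>
    qmax S / (real (card S) - 1) + \<epsilon> / 12 * (ln (real (card S) - 1) - ln (real (card T) - 1))
      \<le> qmax T / (real (card T) - 1) \<and>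
    (real (card T) < M \<or> (\<forall>v\<in>T. (c / 2 - \<epsilon>) * real (card T) < real (card (nbrs T v))))"
  using assms(1,4,9)
proof (induction "card S" arbitrary: S rule: less_induct)
  case less
  define m where "m = real (card S)"
  have m: "M \<le> m" using less.prems by (simp add: m_def)
  show ?case
  proof (cases "\<forall>v\<in>S. (c / 2 - \<epsilon>) * real (card S) < real (card (nbrs S v))")
    case True
    then show ?thesis using less.prems M by (intro exI[of _ S]) auto
  next
    case False
    then obtain v where v: "v \<in> S" "real (card (nbrs S v)) \<le> (c / 2 - \<epsilon>) * real (card S)"
      by (auto simp: not_less)
    have "\<epsilon> * M \<le> \<epsilon> * m" using m \<epsilon> by (intro mult_left_mono) auto
    moreover have "c * (m - 1) \<le> qmax S"
      using less.prems(3) m M by (simp add: m_def field_simps)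
    ultimately obtain w where w: "w \<in> S"
      and step: "qmax S / (m - 1) + \<epsilon> / 12 / (m - 2) \<le> qmax (S - {w}) / (m - 2)"
      using delete_step[OF less.prems(1) _ _ \<epsilon> c _ v] m M unfolding m_def by auto
    have card: "card (S - {w}) = card S - 1" "card S > 0"
      using w less.prems(1) by (auto simp: card_gt_0_iff)
    then have rcard: "real (card (S - {w})) = m - 1" by (simp add: m_def of_nat_diff)
    have "ln ((m - 1) / (m - 2)) \<le> (m - 1) / (m - 2) - 1"
      using m M by (intro ln_le_minus_one) auto
    also have "\<dots> = 1 / (m - 2)" using m M by (simp add: field_simps)
    finally have "ln (m - 1) - ln (m - 2) \<le> 1 / (m - 2)"
      using m M by (simp add: ln_div)
    then have "\<epsilon> / 12 * (ln (m - 1) - ln (m - 2)) \<le> \<epsilon> / 12 * (1 / (m - 2))"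
      using \<epsilon> by (intro mult_left_mono) auto
    also have "\<dots> = \<epsilon> / 12 / (m - 2)" by simp
    finally have "\<epsilon> / 12 * (ln (m - 1) - ln (m - 2)) \<le> \<epsilon> / 12 / (m - 2)" .
    then have gain: "qmax S / (m - 1) + \<epsilon> / 12 * (ln (m - 1) - ln (m - 2)) \<le> qmax (S - {w}) / (m - 2)"
      using step by linarith
    show ?thesis
    proof (cases "M \<le> m - 1")
      case True
      have "0 \<le> ln (m - 1) - ln (m - 2)" using m M by simp
      then have "0 \<le> \<epsilon> / 12 * (ln (m - 1) - ln (m - 2))" using \<epsilon> by simp
      then have "c \<le> qmax (S - {w}) / (real (card (S - {w})) - 1)"
        using gain less.prems(3) by (simp add: rcard m_def)
      then obtain T where T: "T \<subseteq> S - {w}" "2 \<le> card T"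
        "qmax (S - {w}) / (m - 2) + \<epsilon> / 12 * (ln (m - 2) - ln (real (card T) - 1))
          \<le> qmax T / (real (card T) - 1)"
        "real (card T) < M \<or> (\<forall>v\<in>T. (c / 2 - \<epsilon>) * real (card T) < real (card (nbrs T v)))"
        using less.hyps[of "S - {w}"] less.prems(1) card True rcard by auto
      have "qmax S / (m - 1) + \<epsilon> / 12 * (ln (m - 1) - ln (real (card T) - 1)) \<le> qmax T / (real (card T) - 1)"
        using T(3) gain unfolding right_diff_distrib by linarith
      then show ?thesis using T unfolding m_def by blast
    next
      case False
      \<comment> \<open>One more deletion drops below \<open>M\<close>, so \<open>S - {w}\<close>
        itself is the witness.\<close>
      have "2 \<le> card (S - {w})" using rcard m M by linarith
      then show ?thesis using gain False w rcard by (intro exI[of _ "S - {w}"]) (auto simp: m_def)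
    qed
  qed
qed

end

section \<open>Multipartite graphs and the Turan graph\<close>

text \<open>Jensen's inequality for the concave function t/(a + 2t), by comparison with the tangent
  at the mean \<mu>; the linear terms cancel in the sum.\<close>

lemma sum_fraction_le:
  fixes t :: "nat \<Rightarrow> real"
  assumes "0 < a" "k > 0" "\<And>i. i < k \<Longrightarrow> 0 \<le> t i" and \<mu>: "\<mu> = (\<Sum>i<k. t i) / real k"
  shows "(\<Sum>i<k. t i / (a + 2 * t i)) \<le> real k * (\<mu> / (a + 2 * \<mu>))"
proof -
  have \<mu>0: "0 \<le> \<mu>" using assms by (auto simp: \<mu> intro!: divide_nonneg_nonneg sum_nonneg)
  have "t i / (a + 2 * t i) \<le> \<mu> / (a + 2 * \<mu>) + (t i - \<mu>) * (a / (a + 2 * \<mu>)\<^sup>2)" if "i < k" for i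
  proof -
    define u U where "u = a + 2 * t i" and "U = a + 2 * \<mu>"
    have pos: "u > 0" "U > 0" using assms(1,3) that \<mu>0 by (auto simp: u_def U_def intro: add_pos_nonneg)
    have tu: "t i = (u - a) / 2" "\<mu> = (U - a) / 2" by (auto simp: u_def U_def)
    have "\<mu> / U + (t i - \<mu>) * (a / U\<^sup>2) - t i / u = a / 2 * (u - U)\<^sup>2 / (u * U\<^sup>2)"
      unfolding tu using pos by (simp add: divide_simps) (simp add: algebra_simps power2_eq_square)
    also have "\<dots> \<ge> 0" using pos assms by (intro divide_nonneg_pos) auto
    finally show ?thesis by (simp add: u_def U_def)
  qed
  then have "(\<Sum>i<k. t i / (a + 2 * t i)) \<le> (\<Sum>i<k. \<mu> / (a + 2 * \<mu>) + (t i - \<mu>) * (a / (a + 2 * \<mu>)\<^sup>2))"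
    by (intro sum_mono) auto
  also have "\<dots> = real k * (\<mu> / (a + 2 * \<mu>)) + ((\<Sum>i<k. t i) - real k * \<mu>) * (a / (a + 2 * \<mu>)\<^sup>2)"
    by (simp only: sum.distrib sum_distrib_right[symmetric] sum_subtractf sum_constant card_lessThan)
  also have "(\<Sum>i<k. t i) - real k * \<mu> = 0" using \<open>k > 0\<close> by (simp add: \<mu>)
  finally show ?thesis by simp
qed

text \<open>\<open>l\<close> is the secant of t/(a + 2t) through the consecutive integers p and p +
  1. The difference contains the factor (n - p)(n - p - 1), which is nonnegative at every integer
  and zero only at these two. A tangent would not be sharp for balanced parts of two different
  sizes.\<close>

lemma secant_bound:
  fixes a :: real and p n :: nat
  assumes "0 < a"
  defines "l \<equiv> real p / (a + 2 * real p) + (real n - real p) * (a / ((a + 2 * real p) * (a + 2 * real p + 2)))"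
  shows "real n / (a + 2 * real n) \<le> l" "real n / (a + 2 * real n) = l \<longleftrightarrow> n = p \<or> n = Suc p"
proof -
  define u U where "u = a + 2 * real n" and "U = a + 2 * real p"
  have pos: "u > 0" "U > 0" "U + 2 > 0"
    using assms(1) by (auto simp: u_def U_def)
  have tu: "real n = (u - a) / 2" "real p = (U - a) / 2" by (auto simp: u_def U_def)
  have "real p / U + (real n - real p) * (a / (U * (U + 2))) - real n / u =
      2 * a * ((real n - real p) * (real n - real p - 1)) / (u * (U * (U + 2)))"
    unfolding tu using pos by (simp add: divide_simps) (simp add: algebra_simps)
  then have diff: "l - real n / (a + 2 * real n) =
      2 * a * ((real n - real p) * (real n - real p - 1)) / (u * (U * (U + 2)))"
    by (simp add: l_def u_def U_def)
  have "0 \<le> (real n - real p) * (real n - real p - 1)"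
    by (cases "n \<le> p") (auto intro: mult_nonneg_nonneg mult_nonpos_nonpos)
  then have "0 \<le> l - real n / (a + 2 * real n)"
    unfolding diff using pos assms(1)
    by (intro divide_nonneg_pos mult_nonneg_nonneg[of "2 * a"] mult_pos_pos) auto
  then show "real n / (a + 2 * real n) \<le> l" by simp
  have "real n / (a + 2 * real n) = l \<longleftrightarrow> l - real n / (a + 2 * real n) = 0" by auto
  also have "\<dots> \<longleftrightarrow> real n - real p = 0 \<or> real n - real p - 1 = 0"
    unfolding diff using pos assms(1) by simp
  also have "\<dots> \<longleftrightarrow> n = p \<or> n = Suc p" by auto
  finally show "real n / (a + 2 * real n) = l \<longleftrightarrow> n = p \<or> n = Suc p" .
qed

text \<open>The sum of the secant values depends only on the total, and \<open>t\<close> attains it.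
  One size off p and p + 1 would make the sum for \<open>s\<close> strictly smaller.\<close>

lemma balanced_maximizes:
  fixes s t :: "nat \<Rightarrow> nat"
  assumes "0 < a" "(\<Sum>i<k. s i) = (\<Sum>i<k. t i)" and t: "\<And>i. i < k \<Longrightarrow> t i = p \<or> t i = Suc p"
    and ge: "(\<Sum>i<k. real (t i) / (a + 2 * real (t i))) \<le> (\<Sum>i<k. real (s i) / (a + 2 * real (s i)))"
    and "i < k"
  shows "s i = p \<or> s i = Suc p"
proof (rule ccontr)
  assume no: "\<not> ?thesis"
  define g where "g n = real n / (a + 2 * real n)" for n :: nat
  define l where "l n = real p / (a + 2 * real p) + (real n - real p) * (a / ((a + 2 * real p) * (a + 2 * real p + 2)))" for n :: nat
  have le: "g n \<le> l n" and eq: "g n = l n \<longleftrightarrow> n = p \<or> n = Suc p" for n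
    unfolding g_def l_def using secant_bound[OF assms(1), where n = n and p = p] by blast+
  have "g (s i) < l (s i)" using le eq no by (metis less_eq_real_def)
  then have "(\<Sum>i<k. g (s i)) < (\<Sum>i<k. l (s i))"
    using \<open>i < k\<close> le by (intro sum_strict_mono_ex1) auto
  also have "\<dots> = (\<Sum>i<k. l (t i))"
  proof -
    have "(\<Sum>i<k. real (s i)) = (\<Sum>i<k. real (t i))"
      using assms(2) by (metis of_nat_sum)
    then show ?thesis
      unfolding l_def by (simp only: sum.distrib sum_distrib_right[symmetric] sum_subtractf)
  qed
  also have "\<dots> = (\<Sum>i<k. g (t i))" using t eq by (intro sum.cong refl) (metis lessThan_iff)
  finally show False using ge by (simp add: g_def)
qed

context ugraph
begin

text \<open>Sum the eigenvalue equation over a part: the share of the total weight lying in part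
  \<open>i\<close> is at most n i/(a + 2 n i), and the shares add up to 1. Equality means that no
  edge between parts is missing.\<close>

lemma multipartite_qmax:
  fixes f :: "'a \<Rightarrow> nat"
  assumes fin: "finite S" "S \<noteq> {}" and f: "\<And>v. v \<in> S \<Longrightarrow> f v < k"
    and proper: "\<And>u v. u \<in> S \<Longrightarrow> v \<in> S \<Longrightarrow> E u v \<Longrightarrow> f u \<noteq> f v"
    and a: "a = qmax S - real (card S)" "0 < a"
    and n: "\<And>i. n i = card {v \<in> S. f v = i}"
  shows "1 \<le> (\<Sum>i<k. real (n i) / (a + 2 * real (n i)))"
    and "(\<Sum>i<k. real (n i) / (a + 2 * real (n i))) = 1 \<longleftrightarrow>
      (\<forall>u\<in>S. \<forall>v\<in>S. f u \<noteq> f v \<longrightarrow> E u v)"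
proof -
  obtain x where x: "\<And>i. 0 \<le> x i" "(\<Sum>i\<in>S. (x i)\<^sup>2) = 1" "\<And>i. i \<in> S \<Longrightarrow> sl S x i = qmax S * x i"
    using perron[OF fin] by blast
  define P where "P i = {v \<in> S. f v = i}" for i
  define s where "s i = (\<Sum>v\<in>P i. x v)" for i
  define T where "T = (\<Sum>v\<in>S. x v)"
  define m where "m = real (card S)"
  \<comment> \<open>The slack at \<open>v\<close>: what Qx would be at \<open>v\<close> if
    \<open>v\<close> were joined to everything outside its part, minus what it is.\<close>
  define D where "D v = (m - real (n (f v))) * x v + (T - s (f v)) - qmax S * x v" for v
  have finP: "finite (P i)" for i using fin by (simp add: P_def)
  have T: "0 < T"
  proof -
    have "T \<noteq> 0"
    proof
      assume "T = 0"
      then have "\<forall>i\<in>S. x i = 0" using fin x(1) by (simp add: T_def sum_nonneg_eq_0_iff)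
      then show False using x(2) by simp
    qed
    moreover have "0 \<le> T" using x(1) by (simp add: T_def sum_nonneg)
    ultimately show ?thesis by simp
  qed
  have T_eq: "T = (\<Sum>i<k. s i)"
    unfolding T_def s_def P_def using fin f by (intro sum.group[symmetric]) auto
  have out: "card (S - P i) = card S - n i" "(\<Sum>v\<in>S - P i. x v) = T - s i" "n i \<le> card S" for i
  proof -
    have sub: "P i \<subseteq> S" by (auto simp: P_def)
    show "card (S - P i) = card S - n i"
      using sub finP by (simp add: card_Diff_subset n P_def)
    show "(\<Sum>v\<in>S - P i. x v) = T - s i"
      using sub fin by (simp add: sum_diff T_def s_def)
    show "n i \<le> card S" using card_mono[OF fin(1) sub] by (simp add: n P_def)
  qed
  have nb: "nbrs S v \<subseteq> S - P (f v)" if "v \<in> S" for v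
    using proper[OF that] by (fastforce simp: nbrs_def P_def)
  have sl: "qmax S * x v = real (card (nbrs S v)) * x v + (\<Sum>j\<in>nbrs S v. x j)" if "v \<in> S" for v
    using x(3)[OF that] by (simp add: sl_def sum.distrib)
  have slack1: "real (card (nbrs S v)) \<le> m - real (n (f v))" if "v \<in> S" for v
    using card_mono[OF _ nb[OF that]] fin out[of "f v"] by (simp add: m_def of_nat_diff)
  have slack2: "(\<Sum>j\<in>nbrs S v. x j) \<le> T - s (f v)" if "v \<in> S" for v
    unfolding out(2)[symmetric] using nb[OF that] fin x(1) by (intro sum_mono2) auto
  have D0: "0 \<le> D v" if "v \<in> S" for v
  proof -
    have "real (card (nbrs S v)) * x v \<le> (m - real (n (f v))) * x v"
      using slack1[OF that] x(1) by (intro mult_right_mono) auto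
    then show ?thesis using slack2[OF that] sl[OF that] by (simp add: D_def)
  qed
  have sumD: "(\<Sum>v\<in>P i. D v) = real (n i) * T - (a + 2 * real (n i)) * s i" for i
  proof -
    have "(\<Sum>v\<in>P i. D v) = (\<Sum>v\<in>P i. (m - real (n i) - qmax S) * x v + (T - s i))"
      by (intro sum.cong) (auto simp: D_def P_def algebra_simps)
    also have "\<dots> = (m - real (n i) - qmax S) * s i + real (n i) * (T - s i)"
      by (simp add: sum.distrib s_def sum_distrib_left n P_def)
    finally show ?thesis by (simp add: a m_def algebra_simps)
  qed
  have den: "0 < a + 2 * real (n i)" for i using a(2) by linarith
  have "0 \<le> (\<Sum>v\<in>P i. D v)" for i
    using D0 by (intro sum_nonneg) (auto simp: P_def)
  then have s_le: "s i \<le> T * (real (n i) / (a + 2 * real (n i)))" for i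
    unfolding sumD using den[of i] by (simp add: field_simps)
  have "T * 1 \<le> T * (\<Sum>i<k. real (n i) / (a + 2 * real (n i)))"
    using sum_mono[of "{..<k}" s, OF s_le] by (simp only: T_eq[symmetric] sum_distrib_left mult_1_right)
  then show ge: "1 \<le> (\<Sum>i<k. real (n i) / (a + 2 * real (n i)))"
    using T by (rule mult_left_le_imp_le)
  show "(\<Sum>i<k. real (n i) / (a + 2 * real (n i))) = 1 \<longleftrightarrow>
      (\<forall>u\<in>S. \<forall>v\<in>S. f u \<noteq> f v \<longrightarrow> E u v)"
  proof
    assume eq: "(\<Sum>i<k. real (n i) / (a + 2 * real (n i))) = 1"
    have s_eq: "s i = T * (real (n i) / (a + 2 * real (n i)))" if "i < k" for i
    proof (rule ccontr)
      assume "\<not> ?thesis"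
      then have "s i < T * (real (n i) / (a + 2 * real (n i)))" using s_le[of i] by linarith
      then have "(\<Sum>i<k. s i) < (\<Sum>i<k. T * (real (n i) / (a + 2 * real (n i))))"
        using that s_le by (intro sum_strict_mono_ex1) auto
      then show False using eq T_eq by (simp only: sum_distrib_left[symmetric])
    qed
    have "E u v" if uv: "u \<in> S" "v \<in> S" "f u \<noteq> f v" for u v
    proof -
      define i where "i = f u"
      have si: "s i = T * (real (n i) / (a + 2 * real (n i)))"
        using s_eq f[OF uv(1)] by (simp add: i_def)
      then have "(\<Sum>v\<in>P i. D v) = 0" unfolding sumD using den[of i] by (simp add: field_simps)
      then have Du: "D u = 0"
        using D0 finP uv(1) by (subst (asm) sum_nonneg_eq_0_iff) (auto simp: P_def i_def)
      \<comment> \<open>Zero slack shows completeness only at a vertex of positive weight. As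
        \<open>a > 0\<close>, some weight lies outside part \<open>i\<close>, so
        \<open>x u = 0\<close> would leave the positive slack \<open>T - s i\<close>.\<close>
      have "s i < T" unfolding si using T a(2) by (simp add: field_simps add_pos_nonneg)
      then have "x u \<noteq> 0" using Du by (auto simp: D_def i_def)
      then have xu: "0 < x u" using x(1)[of u] by linarith
      have "(m - real (n i) - real (card (nbrs S u))) * x u = 0 \<or> (m - real (n i) - real (card (nbrs S u))) * x u < 0"
        using Du slack2[OF uv(1)] sl[OF uv(1)] by (simp add: D_def i_def algebra_simps) linarith
      then have "m - real (n i) \<le> real (card (nbrs S u))"
        using xu by (auto simp: mult_less_0_iff)
      then have "card (S - P i) \<le> card (nbrs S u)" using out[of i] by (simp add: m_def of_nat_diff)
      then have "nbrs S u = S - P i"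
        using nb[OF uv(1)] fin by (intro card_seteq) (auto simp: i_def)
      moreover have "v \<in> S - P i" using uv by (auto simp: P_def i_def)
      ultimately show "E u v" by (auto simp: nbrs_def)
    qed
    then show "\<forall>u\<in>S. \<forall>v\<in>S. f u \<noteq> f v \<longrightarrow> E u v" by blast
  next
    assume comp: "\<forall>u\<in>S. \<forall>v\<in>S. f u \<noteq> f v \<longrightarrow> E u v"
    have "D v = 0" if "v \<in> S" for v
    proof -
      have "nbrs S v = S - P (f v)" using nb[OF that] comp that by (auto simp: nbrs_def P_def)
      then show ?thesis using sl[OF that] out[of "f v"] by (simp add: D_def m_def of_nat_diff)
    qed
    then have "(\<Sum>v\<in>P i. D v) = 0" for i by (intro sum.neutral) (auto simp: P_def)
    then have s_eq: "s i = T * (real (n i) / (a + 2 * real (n i)))" for i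
      using sumD[of i] den[of i] by (simp add: field_simps)
    have "T * 1 = (\<Sum>i<k. s i)" using T_eq by simp
    also have "\<dots> = (\<Sum>i<k. T * (real (n i) / (a + 2 * real (n i))))"
      by (intro sum.cong refl s_eq)
    also have "\<dots> = T * (\<Sum>i<k. real (n i) / (a + 2 * real (n i)))"
      by (rule sum_distrib_left[symmetric])
    finally show "(\<Sum>i<k. real (n i) / (a + 2 * real (n i))) = 1"
      using T mult_left_cancel by (metis less_irrefl)
  qed
qed

lemma sum_card_parts:
  fixes f :: "'a \<Rightarrow> nat"
  assumes "finite S" "\<And>v. v \<in> S \<Longrightarrow> f v < k"
  shows "(\<Sum>i<k. card {v \<in> S. f v = i}) = card S"
  using sum.group[OF assms(1), of "{..<k}" f "\<lambda>_. 1 :: nat"] assms(2) by auto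

text \<open>If q exceeds the order, the part inequality applies and Jensen replaces all parts by
  their mean; otherwise 2 - 2/k \<ge> 1 suffices.\<close>

lemma multipartite_qmax_le:
  fixes f :: "'a \<Rightarrow> nat"
  assumes fin: "finite S" "S \<noteq> {}" and "k \<ge> 2" and f: "\<And>v. v \<in> S \<Longrightarrow> f v < k"
    and proper: "\<And>u v. u \<in> S \<Longrightarrow> v \<in> S \<Longrightarrow> E u v \<Longrightarrow> f u \<noteq> f v"
  shows "qmax S \<le> (2 - 2 / real k) * real (card S)"
proof (cases "qmax S \<le> real (card S)")
  case True
  have "1 * real (card S) \<le> (2 - 2 / real k) * real (card S)"
    using \<open>k \<ge> 2\<close> by (intro mult_right_mono) auto
  then show ?thesis using True by simp
next
  case False
  define m where "m = real (card S)"
  define a where "a = qmax S - m"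
  define t where "t i = real (card {v \<in> S. f v = i})" for i
  have a: "0 < a" using False by (simp add: a_def m_def)
  have k: "real k \<ge> 2" using \<open>k \<ge> 2\<close> by simp
  have "(\<Sum>i<k. t i) = m"
    using sum_card_parts[OF fin(1) f] by (simp add: t_def m_def flip: of_nat_sum)
  then have "(\<Sum>i<k. t i / (a + 2 * t i)) \<le> real k * ((m / real k) / (a + 2 * (m / real k)))"
    using a k by (intro sum_fraction_le) (auto simp: t_def)
  moreover have "1 \<le> (\<Sum>i<k. t i / (a + 2 * t i))"
    unfolding t_def by (rule multipartite_qmax(1)[OF fin f proper]) (use a in \<open>auto simp: a_def m_def\<close>)
  ultimately have "1 \<le> real k * ((m / real k) / (a + 2 * (m / real k)))" by linarith
  also have "\<dots> = m / (a + 2 * (m / real k))" using k by simp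
  finally have "a + 2 * (m / real k) \<le> m"
    using a by (simp add: m_def le_divide_eq split: if_splits)
  then show ?thesis by (simp add: a_def m_def algebra_simps)
qed

end

section \<open>The Turan graph: part sizes, Q-index, recognition and extremality\<close>

lemma card_residue_class:
  assumes "i < k"
  shows "card {v \<in> {..<n}. v mod k = i} = n div k \<or> card {v \<in> {..<n}. v mod k = i} = Suc (n div k)"
proof -
  have inj: "inj_on (\<lambda>j. i + k * j) A" for A using assms by (auto simp: inj_on_def)
  have lo: "(\<lambda>j. i + k * j) ` {..<n div k} \<subseteq> {v \<in> {..<n}. v mod k = i}"
  proof (clarsimp simp: assms)
    fix j assume "j < n div k"
    then have "k * Suc j \<le> k * (n div k)" by (intro mult_le_mono2) auto
    also have "\<dots> \<le> n" by simp
    finally show "i + k * j < n" using assms by simp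
  qed
  have hi: "{v \<in> {..<n}. v mod k = i} \<subseteq> (\<lambda>j. i + k * j) ` {..n div k}"
  proof clarsimp
    fix v assume "v < n" "i = v mod k"
    then show "v \<in> (\<lambda>j. v mod k + k * j) ` {..n div k}"
      by (intro image_eqI[of _ _ "v div k"]) (auto intro: div_le_mono)
  qed
  have "n div k \<le> card {v \<in> {..<n}. v mod k = i}"
    using card_mono[OF _ lo] card_image[OF inj] by simp
  moreover have "card {v \<in> {..<n}. v mod k = i} \<le> Suc (n div k)"
    using card_mono[OF _ hi] card_image[OF inj] by simp
  ultimately show ?thesis by linarith
qed

lemma graph_turan: "graph n (turan n k)"
  by (auto simp: graph_def turan_def)

text \<open>The constant test vector is good enough: part sizes differ from n/k by at most 1, so the
  sum of their squares is within k of its minimum, and the loss 2k/n tends to 0.\<close>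

lemma turan_qmax_ge:
  assumes "k \<ge> 1" "n > 0"
  shows "(2 - 2 / real k) * real n - 2 * real k / real n \<le> ugraph.qmax (turan n k) {..<n}"
proof -
  interpret ugraph "turan n k" by (rule ugraph_graph[OF graph_turan])
  define t where "t i = card {v \<in> {..<n}. v mod k = i}" for i
  have k: "real k \<ge> 1" using assms by simp
  have sum_t: "(\<Sum>i<k. real (t i)) = real n"
    using sum_card_parts[of "{..<n}" "\<lambda>v. v mod k" k] assms by (simp add: t_def flip: of_nat_sum)
  have "(real (t i) - real n / real k)\<^sup>2 \<le> 1" if "i < k" for i
  proof -
    have "real n / real k = real (n div k) + real (n mod k) / real k"
    proof -
      have "real n = real k * real (n div k) + real (n mod k)"
        by (metis mult_div_mod_eq of_nat_add of_nat_mult)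
      then have "real n / real k = (real k * real (n div k) + real (n mod k)) / real k" by simp
      then show ?thesis using k by (simp add: add_divide_distrib)
    qed
    moreover have "0 \<le> real (n mod k) / real k" "real (n mod k) / real k \<le> 1"
      using that by (auto simp: less_imp_le)
    ultimately have "\<bar>real (t i) - real n / real k\<bar> \<le> 1"
      using card_residue_class[OF that, of n] by (auto simp: t_def)
    then show ?thesis by (simp add: abs_square_le_1)
  qed
  then have "(\<Sum>i<k. (real (t i) - real n / real k)\<^sup>2) \<le> real (card {..<k}) * 1"
    by (intro sum_bounded_above) auto
  moreover have "(\<Sum>i<k. (real (t i) - real n / real k)\<^sup>2) =
      (\<Sum>i<k. (real (t i))\<^sup>2) - 2 * (real n / real k) * (\<Sum>i<k. real (t i)) + real k * (real n / real k)\<^sup>2"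
  proof -
    have "(\<Sum>i<k. (real (t i) - r)\<^sup>2) = (\<Sum>i<k. (real (t i))\<^sup>2) - 2 * r * (\<Sum>i<k. real (t i)) + real k * r\<^sup>2" for r
      by (simp add: power2_diff sum.distrib sum_subtractf sum_distrib_left algebra_simps)
    then show ?thesis .
  qed
  then have "(\<Sum>i<k. (real (t i) - real n / real k)\<^sup>2) =
      (\<Sum>i<k. (real (t i))\<^sup>2) - 2 * (real n / real k) * real n + real k * (real n / real k)\<^sup>2"
    unfolding sum_t .
  ultimately have sq: "(\<Sum>i<k. (real (t i))\<^sup>2) \<le> (real n)\<^sup>2 / real k + real k"
    using k by (simp add: power2_eq_square)
  have deg: "real (card (nbrs {..<n} v)) = real n - real (t (v mod k))" if "v < n" for v
  proof -
    have "nbrs {..<n} v = {..<n} - {u \<in> {..<n}. u mod k = v mod k}"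
      using that by (auto simp: nbrs_def turan_def)
    then have "card (nbrs {..<n} v) = n - t (v mod k)"
      unfolding t_def by (simp only:) (subst card_Diff_subset; auto)
    moreover have "t (v mod k) \<le> n"
      unfolding t_def using card_mono[of "{..<n}" "{u \<in> {..<n}. u mod k = v mod k}"] by fastforce
    ultimately show ?thesis by (simp add: of_nat_diff)
  qed
  have "(\<Sum>v<n. real (t (v mod k))) = (\<Sum>i<k. \<Sum>v\<in>{v \<in> {..<n}. v mod k = i}. real (t (v mod k)))"
    using assms by (intro sum.group[symmetric]) auto
  also have "\<dots> = (\<Sum>i<k. real (t i) * real (t i))"
    by (intro sum.cong) (auto simp: t_def)
  finally have "(\<Sum>v<n. real (card (nbrs {..<n} v))) = (real n)\<^sup>2 - (\<Sum>i<k. (real (t i))\<^sup>2)"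
    by (simp add: deg sum_subtractf power2_eq_square)
  then have "2 * ((real n)\<^sup>2 - ((real n)\<^sup>2 / real k + real k)) \<le> qmax {..<n} * real n"
    using average_degree_le_qmax[of "{..<n}"] assms sq by (simp add: lessThan_empty_iff)
  then have "2 * ((real n)\<^sup>2 - ((real n)\<^sup>2 / real k + real k)) / real n \<le> qmax {..<n}"
    using assms by (simp add: divide_le_eq)
  moreover have "2 * ((real n)\<^sup>2 - ((real n)\<^sup>2 / real k + real k)) / real n =
      (2 - 2 / real k) * real n - 2 * real k / real n"
    using assms by (simp add: field_simps power2_eq_square)
  ultimately show ?thesis by simp
qed

text \<open>When only the values p and p + 1 occur, the total determines how often each is
  taken.\<close>

lemma ex_permutation_matching:
  fixes s t :: "nat \<Rightarrow> nat"
  assumes sum: "(\<Sum>i<k. s i) = (\<Sum>i<k. t i)"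
    and s: "\<And>i. i < k \<Longrightarrow> s i = p \<or> s i = Suc p" and t: "\<And>i. i < k \<Longrightarrow> t i = p \<or> t i = Suc p"
  obtains \<sigma> where "bij_betw \<sigma> {..<k} {..<k}" "\<And>i. i < k \<Longrightarrow> t (\<sigma> i) = s i"
proof -
  have count: "(\<Sum>i<k. r i) = k * p + card {i \<in> {..<k}. r i = Suc p}"
    if "\<And>i. i < k \<Longrightarrow> r i = p \<or> r i = Suc p" for r :: "nat \<Rightarrow> nat"
  proof -
    have "(\<Sum>i<k. r i) = (\<Sum>i<k. p + (if r i = Suc p then 1 else 0))"
      using that by (intro sum.cong) auto
    then show ?thesis by (simp add: sum.distrib sum.If_cases Int_def)
  qed
  have c1: "card {i \<in> {..<k}. s i = Suc p} = card {i \<in> {..<k}. t i = Suc p}"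
    using sum by (simp only: count[OF s] count[OF t])
  have compl: "card {i \<in> {..<k}. r i \<noteq> Suc p} = k - card {i \<in> {..<k}. r i = Suc p}" for r :: "nat \<Rightarrow> nat"
  proof -
    have "{i \<in> {..<k}. r i \<noteq> Suc p} = {..<k} - {i \<in> {..<k}. r i = Suc p}" by auto
    then show ?thesis by (simp only:) (subst card_Diff_subset; auto)
  qed
  obtain g where g: "bij_betw g {i \<in> {..<k}. s i = Suc p} {i \<in> {..<k}. t i = Suc p}"
    using finite_same_card_bij[OF _ _ c1] by auto
  obtain h where h: "bij_betw h {i \<in> {..<k}. s i \<noteq> Suc p} {i \<in> {..<k}. t i \<noteq> Suc p}"
    using finite_same_card_bij[of "{i \<in> {..<k}. s i \<noteq> Suc p}" "{i \<in> {..<k}. t i \<noteq> Suc p}"] c1 compl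
    by auto
  define \<sigma> where "\<sigma> i = (if i \<in> {i \<in> {..<k}. s i = Suc p} then g i else h i)" for i
  have "bij_betw \<sigma> ({i \<in> {..<k}. s i = Suc p} \<union> {i \<in> {..<k}. s i \<noteq> Suc p})
      ({i \<in> {..<k}. t i = Suc p} \<union> {i \<in> {..<k}. t i \<noteq> Suc p})"
    unfolding \<sigma>_def by (rule bij_betw_disjoint_Un[OF g h]) auto
  moreover have "{i \<in> {..<k}. r i = Suc p} \<union> {i \<in> {..<k}. r i \<noteq> Suc p} = {..<k}" for r :: "nat \<Rightarrow> nat"
    by auto
  ultimately have "bij_betw \<sigma> {..<k} {..<k}" by simp
  moreover have "t (\<sigma> i) = s i" if "i < k" for i
  proof (cases "s i = Suc p")
    case True
    then show ?thesis using that bij_betwE[OF g] by (auto simp: \<sigma>_def)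
  next
    case False
    then have "h i < k" "t (h i) \<noteq> Suc p" using that bij_betwE[OF h] by auto
    then show ?thesis using that False s[OF that] t[of "h i"] by (auto simp: \<sigma>_def)
  qed
  ultimately show thesis by (rule that)
qed

lemma isomorphic_turan:
  assumes "graph n E" "k \<ge> 1" and f: "\<And>v. v < n \<Longrightarrow> f v < k"
    and E: "\<And>u v. u < n \<Longrightarrow> v < n \<Longrightarrow> E u v \<longleftrightarrow> f u \<noteq> f v"
    and bal: "\<And>i. i < k \<Longrightarrow> card {v \<in> {..<n}. f v = i} = n div k \<or> card {v \<in> {..<n}. f v = i} = Suc (n div k)"
  shows "isomorphic n E (turan n k)"
proof -
  interpret ugraph E by (rule ugraph_graph[OF assms(1)])
  have sums: "(\<Sum>i<k. card {v \<in> {..<n}. f v = i}) = (\<Sum>i<k. card {v \<in> {..<n}. v mod k = i})"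
    using sum_card_parts[of "{..<n}" f k] sum_card_parts[of "{..<n}" "\<lambda>v. v mod k" k] f assms(2) by simp
  obtain \<sigma> where \<sigma>: "bij_betw \<sigma> {..<k} {..<k}"
    "\<And>i. i < k \<Longrightarrow> card {v \<in> {..<n}. v mod k = \<sigma> i} = card {v \<in> {..<n}. f v = i}"
    using ex_permutation_matching[OF sums bal card_residue_class] by metis
  have "\<exists>h. bij_betw h {v \<in> {..<n}. f v = i} {v \<in> {..<n}. v mod k = \<sigma> i}" if "i < k" for i
    using \<sigma>(2)[OF that] by (intro finite_same_card_bij) auto
  then obtain h where h: "\<And>i. i < k \<Longrightarrow> bij_betw (h i) {v \<in> {..<n}. f v = i} {v \<in> {..<n}. v mod k = \<sigma> i}"
    by metis
  define F where "F v = h (f v) v" for v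
  have F: "F v < n" "F v mod k = \<sigma> (f v)" if "v < n" for v
    using bij_betwE[OF h[OF f[OF that]]] that by (auto simp: F_def)
  have \<sigma>_inj: "\<sigma> i = \<sigma> j \<longleftrightarrow> i = j" if "i < k" "j < k" for i j
    using \<sigma>(1) that by (auto simp: bij_betw_def inj_on_def)
  have "inj_on F {..<n}"
  proof (rule inj_onI)
    fix u v assume uv: "u \<in> {..<n}" "v \<in> {..<n}" "F u = F v"
    then have lt: "u < n" "v < n" by auto
    have "\<sigma> (f u) = \<sigma> (f v)" using F(2)[OF lt(1)] F(2)[OF lt(2)] uv(3) by simp
    then have fuv: "f u = f v" using \<sigma>_inj f lt by blast
    then have "h (f u) u = h (f u) v" using uv(3) by (simp add: F_def)
    moreover have "u \<in> {w \<in> {..<n}. f w = f u}" "v \<in> {w \<in> {..<n}. f w = f u}"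
      using lt fuv by auto
    ultimately show "u = v"
      using inj_onD[OF bij_betw_imp_inj_on[OF h[OF f[OF lt(1)]]]] by blast
  qed
  moreover have "F ` {..<n} \<subseteq> {..<n}" using F by auto
  ultimately have "bij_betw F {..<n} {..<n}"
    by (simp add: bij_betw_def endo_inj_surj)
  moreover have "E u v \<longleftrightarrow> turan n k (F u) (F v)" if "u < n" "v < n" for u v
    unfolding turan_def F(2)[OF that(1)] F(2)[OF that(2)] E[OF that]
    using F(1) \<sigma>_inj[OF f f] that by auto
  ultimately show ?thesis unfolding isomorphic_def by blast
qed

text \<open>The Turan graph's fraction sum equals 1 at its own parameter \<open>b\<close> and
  decreases with the parameter, so it is at most 1 at \<open>a \<ge> b\<close>, where the sum for
  \<open>G\<close> is at least 1. Hence the parts of \<open>G\<close> are balanced, both sums agree,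
  and the equality case makes \<open>G\<close> complete multipartite.\<close>

lemma multipartite_extremal:
  assumes "graph n E" "k \<ge> 2" "n > 0" and f: "\<And>v. v < n \<Longrightarrow> f v < k"
    and proper: "\<And>u v. u < n \<Longrightarrow> v < n \<Longrightarrow> E u v \<Longrightarrow> f u \<noteq> f v"
    and ge: "q n (turan n k) \<le> q n E" and large: "real n < q n (turan n k)"
  shows "isomorphic n E (turan n k)"
proof -
  interpret ugraph E by (rule ugraph_graph[OF assms(1)])
  interpret T: ugraph "turan n k" by (rule ugraph_graph[OF graph_turan])
  define a where "a = q n E - real n"
  define b where "b = q n (turan n k) - real n"
  define s where "s i = card {v \<in> {..<n}. f v = i}" for i
  define t where "t i = card {v \<in> {..<n}. v mod k = i}" for i
  have ab: "0 < b" "b \<le> a" using ge large by (simp_all add: a_def b_def)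
  have ne: "{..<n} \<noteq> {}" using assms(3) by auto
  have a: "a = qmax {..<n} - real (card {..<n})" "0 < a"
    using q_eq_qmax[OF assms(1,3)] ab by (simp_all add: a_def)
  have b: "b = T.qmax {..<n} - real (card {..<n})"
    using q_eq_qmax[OF graph_turan assms(3)] by (simp add: b_def)
  note G = multipartite_qmax[OF _ ne _ _ a, where f = f and k = k and n = s]
  have s1: "1 \<le> (\<Sum>i<k. real (s i) / (a + 2 * real (s i)))"
    by (rule G(1)) (use f proper in \<open>auto simp: s_def\<close>)
  have "(\<Sum>i<k. real (t i) / (b + 2 * real (t i))) = 1"
    by (subst T.multipartite_qmax(2)[OF _ ne _ _ b ab(1), of "\<lambda>v. v mod k"])
      (use assms(2) in \<open>auto simp: t_def turan_def\<close>)
  moreover have "(\<Sum>i<k. real (t i) / (a + 2 * real (t i))) \<le> (\<Sum>i<k. real (t i) / (b + 2 * real (t i)))"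
    using ab by (intro sum_mono divide_left_mono) (auto intro!: mult_pos_pos add_pos_nonneg)
  ultimately have t1: "(\<Sum>i<k. real (t i) / (a + 2 * real (t i))) \<le> 1" by simp
  have sums: "(\<Sum>i<k. s i) = (\<Sum>i<k. t i)"
    using sum_card_parts[of "{..<n}" f k] sum_card_parts[of "{..<n}" "\<lambda>v. v mod k" k] f assms(2)
    by (simp add: s_def t_def)
  have bal: "s i = n div k \<or> s i = Suc (n div k)" if "i < k" for i
    by (rule balanced_maximizes[OF a(2) sums _ _ that])
      (use card_residue_class s1 t1 in \<open>auto simp: t_def\<close>)
  have "(\<Sum>i<k. real (s i) / (a + 2 * real (s i))) \<le> 1"
  proof (rule ccontr)
    assume gt: "\<not> ?thesis"
    obtain \<sigma> where \<sigma>: "bij_betw \<sigma> {..<k} {..<k}" "\<And>i. i < k \<Longrightarrow> t (\<sigma> i) = s i"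
      using ex_permutation_matching[OF sums bal] card_residue_class unfolding t_def by blast
    have "(\<Sum>i<k. real (s i) / (a + 2 * real (s i))) = (\<Sum>i<k. real (t (\<sigma> i)) / (a + 2 * real (t (\<sigma> i))))"
      using \<sigma>(2) by (intro sum.cong) auto
    also have "\<dots> = (\<Sum>i<k. real (t i) / (a + 2 * real (t i)))"
      using sum.reindex_bij_betw[OF \<sigma>(1)] .
    finally show False using t1 gt by simp
  qed
  then have "(\<Sum>i<k. real (s i) / (a + 2 * real (s i))) = 1" using s1 by simp
  then have "\<forall>u\<in>{..<n}. \<forall>v\<in>{..<n}. f u \<noteq> f v \<longrightarrow> E u v"
    by (subst (asm) G(2)) (use f proper in \<open>auto simp: s_def\<close>)
  then show ?thesis
    using f proper assms(2) by (intro isomorphic_turan[OF assms(1) _ _ _ bal[unfolded s_def]]) auto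
qed


section \<open>Combining colouring, deletion and extremality\<close>

lemma card_le_js:
  assumes "u < n" "v < n" "E u v"
  shows "card {S \<in> cliques r n E. u \<in> S \<and> v \<in> S} \<le> js r n E"
  unfolding js_def
proof (rule Max_ge)
  have "{card {S \<in> cliques r n E. u \<in> S \<and> v \<in> S} | u v. u < n \<and> v < n \<and> E u v} \<subseteq>
      (\<lambda>(u, v). card {S \<in> cliques r n E. u \<in> S \<and> v \<in> S}) ` ({..<n} \<times> {..<n})"
    by auto
  then show "finite ({card {S \<in> cliques r n E. u \<in> S \<and> v \<in> S} | u v. u < n \<and> v < n \<and> E u v} \<union> {0})"
    by (simp add: finite_subset)
qed (use assms in auto)

lemma few_joints_imp_multipartite:
  assumes "graph n E" "k \<ge> 3" and \<epsilon>: "\<epsilon> = 1 / (20 * real k ^ 5)"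
    and T: "T \<subseteq> {..<n}" "T \<noteq> {}"
    and deg: "\<And>v. v \<in> T \<Longrightarrow> (1 - 1 / real k - \<epsilon>) * real (card T) < real (card (ugraph.nbrs E T v))"
    and few: "real (js (k + 1) n E) < (2 * \<epsilon> * real (card T) / real k) ^ (k - 1)"
  obtains f :: "nat \<Rightarrow> nat" where "\<And>u. u \<in> T \<Longrightarrow> f u < k" "\<And>u v. u \<in> T \<Longrightarrow> v \<in> T \<Longrightarrow> E u v \<Longrightarrow> f u \<noteq> f v"
proof -
  interpret ugraph E by (rule ugraph_graph[OF assms(1)])
  have fin: "finite T" using T(1) finite_subset by blast
  have few': "real (card {C \<in> cliques_in T (k + 1). u \<in> C \<and> v \<in> C})
      < (2 * \<epsilon> * real (card T) / real k) ^ (k - 1)" if "u \<in> T" "v \<in> T" "E u v" for u v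
  proof -
    have "finite {C \<in> cliques (k + 1) n E. u \<in> C \<and> v \<in> C}"
      by (rule finite_subset[of _ "Pow {..<n}"]) (auto simp: cliques_def)
    then have "card {C \<in> cliques_in T (k + 1). u \<in> C \<and> v \<in> C} \<le> card {C \<in> cliques (k + 1) n E. u \<in> C \<and> v \<in> C}"
      using T(1) by (intro card_mono) (auto simp: cliques_in_def cliques_def)
    also have "\<dots> \<le> js (k + 1) n E" using that T(1) by (intro card_le_js) auto
    finally have "real (card {C \<in> cliques_in T (k + 1). u \<in> C \<and> v \<in> C}) \<le> real (js (k + 1) n E)"
      by (rule of_nat_mono)
    then show ?thesis using few by linarith
  qed
  show thesis
  proof (rule multipartite_if_few_joints[OF fin T(2) assms(2) \<epsilon>])
    fix f :: "nat \<Rightarrow> nat"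
    assume "\<And>u. u \<in> T \<Longrightarrow> f u < k" "\<And>u v. u \<in> T \<Longrightarrow> v \<in> T \<Longrightarrow> E u v \<Longrightarrow> f u \<noteq> f v"
    then show thesis by (rule that)
  next
    show "(1 - 1 / real k - \<epsilon>) * real (card T) < real (card (nbrs T v))" if "v \<in> T" for v
      using deg[OF that] .
    show "real (card {C \<in> cliques_in T (k + 1). u \<in> C \<and> v \<in> C}) < (2 * \<epsilon> * real (card T) / real k) ^ (k - 1)"
      if "u \<in> T" "v \<in> T" "E u v" for u v
      using few'[OF that] .
  qed
qed

text \<open>The logarithmic gain accumulated by deleting even one vertex already beats the gap
  between the \<open>Q\<close>-index of the Turan graph and the bound for \<open>k\<close>-partite graphs.\<close>

lemma no_deletion:
  fixes c \<kappa> n t s \<rho> \<tau> :: real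
  assumes gain: "\<rho> / (n - 1) + \<kappa> * (ln (n - 1) - ln (t - 1)) \<le> \<tau> / (t - 1)"
    and \<rho>: "c * n - s \<le> \<rho>" and \<tau>: "\<tau> \<le> c * t" and c: "0 \<le> c" and "0 < \<kappa>" "1 < t" "t + 1 \<le> n"
    and s: "s < \<kappa> / 2" and t: "2 * c \<le> \<kappa> * (t - 1)"
  shows False
proof -
  have "ln ((t - 1) / (n - 1)) \<le> (t - 1) / (n - 1) - 1"
    using assms by (intro ln_le_minus_one divide_pos_pos) auto
  also have "\<dots> = - ((n - t) / (n - 1))" using assms by (simp add: field_simps)
  finally have "(n - t) / (n - 1) \<le> ln (n - 1) - ln (t - 1)"
    using assms by (simp add: ln_div)
  then have "\<kappa> * ((n - t) / (n - 1)) \<le> \<kappa> * (ln (n - 1) - ln (t - 1))"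
    using assms by (intro mult_left_mono) auto
  moreover have "(c * n - s) / (n - 1) \<le> \<rho> / (n - 1)"
    using \<rho> assms by (intro divide_right_mono) auto
  moreover have "\<tau> / (t - 1) \<le> c * t / (t - 1)"
    using \<tau> assms by (intro divide_right_mono) auto
  ultimately have "(c * n - s) / (n - 1) + \<kappa> * ((n - t) / (n - 1)) \<le> c * t / (t - 1)"
    using gain by linarith
  then have "((c * n - s) / (n - 1) + \<kappa> * ((n - t) / (n - 1))) * (n - 1) \<le> c * t / (t - 1) * (n - 1)"
    using assms by (intro mult_right_mono) auto
  then have "c * n - s + \<kappa> * (n - t) \<le> c * t / (t - 1) * (n - 1)"
    using assms by (simp add: distrib_right)
  also have "c * t / (t - 1) * (n - 1) = c * n + c / (t - 1) * (n - t)"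
    using assms by (simp add: field_simps)
  \<comment> \<open>The shift by one in the denominators costs c/(t - 1) per deleted vertex, at most
    half of the gain \<kappa>. The other half, over at least one deleted vertex, already exceeds
    \<open>s\<close>.\<close>
  also have "c / (t - 1) * (n - t) \<le> \<kappa> / 2 * (n - t)"
    using assms by (intro mult_right_mono) (auto simp: field_simps)
  finally have "\<kappa> / 2 * (n - t) \<le> s" by (simp add: field_simps)
  moreover have "\<kappa> / 2 * 1 \<le> \<kappa> / 2 * (n - t)" using assms by (intro mult_left_mono) auto
  ultimately show False using s by linarith
qed

theorem theorem2p9:
  fixes k :: nat
  assumes "k \<ge> 3"
  shows "\<exists>c::real > 0. \<exists>n0::nat. \<forall>n \<ge> n0. \<forall>E.
           graph n E \<and> q n E \<ge> q n (turan n k) \<and> \<not> isomorphic n E (turan n k)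
           \<longrightarrow> real (js (k + 1) n E) \<ge> c * real n ^ (k - 1)"
proof -
  have k: "real k \<ge> 3" using assms by simp
  define \<epsilon> where "\<epsilon> = 1 / (20 * real k ^ 5)"
  define \<kappa> where "\<kappa> = \<epsilon> / 12"
  define b where "b = 2 - 2 / real k"
  \<comment> \<open>The summand 2/\<epsilon> secures 2 \<le> \<epsilon>M, and 4/\<kappa> secures 2b
    \<le> \<kappa>(M - 1) since b \<le> 2.\<close>
  define M where "M = 9 + 2 / \<epsilon> + 4 / \<kappa>"
  \<comment> \<open>The ratio stays at most 2, so the logarithms differ by at most 2/\<kappa>: at
    least this fraction of the vertices survives.\<close>
  define r where "r = exp (- (2 / \<kappa>))"
  define c where "c = (2 * \<epsilon> * r / real k) ^ (k - 1)"
  \<comment> \<open>M/r keeps the surviving order above \<open>M\<close>, 4k/\<kappa> makes the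
    Turan defect 2k/n smaller than \<kappa>/2, and 2k makes it at most 1.\<close>
  define n0 where "n0 = nat \<lceil>M / r + 2 + 4 * real k / \<kappa> + 2 * real k\<rceil>"
  have "1 \<le> real k ^ 5" using k by (intro one_le_power) auto
  then have "1 \<le> 20 * real k ^ 5" by linarith
  then have \<epsilon>: "0 < \<epsilon>" "\<epsilon> \<le> 1" using k unfolding \<epsilon>_def by (auto simp: divide_le_eq_1)
  then have \<kappa>: "0 < \<kappa>" by (simp add: \<kappa>_def)
  have b: "4 / 3 \<le> b" "b \<le> 2" using k by (auto simp: b_def field_simps)
  have r: "0 < r" "r \<le> 1" using \<kappa> by (auto simp: r_def)
  have M: "9 \<le> M" "2 \<le> \<epsilon> * M" "2 * b \<le> \<kappa> * (M - 1)"
  proof -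
    show "9 \<le> M" using \<epsilon> \<kappa> by (simp add: M_def)
    have "\<epsilon> * M = 9 * \<epsilon> + 2 + 4 * \<epsilon> / \<kappa>" using \<epsilon> by (simp add: M_def algebra_simps)
    then show "2 \<le> \<epsilon> * M" using \<epsilon> \<kappa> by simp
    have "\<kappa> * (M - 1) = 8 * \<kappa> + 2 * \<kappa> / \<epsilon> + 4" using \<kappa> by (simp add: M_def algebra_simps)
    moreover have "0 < 2 * \<kappa> / \<epsilon>" using \<epsilon> \<kappa> by simp
    ultimately show "2 * b \<le> \<kappa> * (M - 1)" using \<kappa> b by linarith
  qed
  have "c > 0" using \<epsilon> r k by (simp add: c_def)
  moreover have "c * real n ^ (k - 1) \<le> real (js (k + 1) n E)"
    if n: "n \<ge> n0" and E: "graph n E" and ge: "q n (turan n k) \<le> q n E"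
      and not_iso: "\<not> isomorphic n E (turan n k)" for n E
  proof (rule ccontr)
    assume "\<not> ?thesis"
    then have few: "real (js (k + 1) n E) < c * real n ^ (k - 1)" by simp
    interpret ugraph E by (rule ugraph_graph[OF E])
    have n_ge: "M / r + 2 + 4 * real k / \<kappa> + 2 * real k \<le> real n"
      using n unfolding n0_def by linarith
    have "M * 1 \<le> M / r" using M r by (simp add: field_simps)
    moreover have "0 < 4 * real k / \<kappa>" using \<kappa> k by simp
    ultimately have nM: "M \<le> real n" "2 * real k \<le> real n" "4 * real k / \<kappa> < real n" "M / r \<le> real n - 1"
      using n_ge k M by linarith+
    have n0: "n > 0" using nM k by simp
    define s where "s = 2 * real k / real n"
    have s: "0 \<le> s" "s \<le> 1" "s < \<kappa> / 2"
      using nM n0 \<kappa> by (auto simp: s_def field_simps)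
    have qT: "b * real n - s \<le> q n (turan n k)"
      using turan_qmax_ge[of k n] assms n0 q_eq_qmax[OF graph_turan n0] by (simp add: b_def s_def)
    have qE: "q n E = qmax {..<n}" by (rule q_eq_qmax[OF E n0])
    have \<rho>: "b * real n - s \<le> qmax {..<n}" using qT ge qE by simp
    have start: "b \<le> qmax {..<n} / (real (card {..<n}) - 1)"
    proof -
      \<comment> \<open>The \<open>- 1\<close> in the denominator absorbs the defect of the Turan
        bound, as s \<le> 1 \<le> b.\<close>
      have "b * (real n - 1) \<le> qmax {..<n}" using \<rho> s b by (simp add: algebra_simps)
      then show ?thesis using nM M by (simp add: le_divide_eq)
    qed
    obtain T where T: "T \<subseteq> {..<n}" "2 \<le> card T"
      and gain: "qmax {..<n} / (real n - 1) + \<kappa> * (ln (real n - 1) - ln (real (card T) - 1))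
          \<le> qmax T / (real (card T) - 1)"
      and T_deg: "real (card T) < M \<or> (\<forall>v\<in>T. (b / 2 - \<epsilon>) * real (card T) < real (card (nbrs T v)))"
      using ex_large_min_degree_subset[of "{..<n}" M \<epsilon> b] M nM \<epsilon> b start by (auto simp: \<kappa>_def)
    define t where "t = real (card T)"
    have finT: "finite T" "T \<noteq> {}" using T finite_subset by fastforce+
    have t2: "2 \<le> t" using T by (simp add: t_def)
    have "qmax T / (t - 1) \<le> 2"
      using qmax_le[OF finT] t2 by (simp add: t_def divide_le_eq)
    then have "\<kappa> * (ln (real n - 1) - ln (t - 1)) \<le> 2"
      using gain start b by (simp add: t_def)
    then have "ln (real n - 1) - ln (t - 1) \<le> 2 / \<kappa>"
      using \<kappa> by (simp add: le_divide_eq mult.commute)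
    then have "ln ((real n - 1) * r) \<le> ln (t - 1)"
      using nM M r t2 by (simp add: ln_mult r_def)
    then have t_ge: "(real n - 1) * r \<le> t - 1"
      using nM M r t2 by (subst (asm) ln_le_cancel_iff) auto
    \<comment> \<open>This excludes the alternative that the process ran below \<open>M\<close>, so
      the minimum degree condition holds in \<open>T\<close>.\<close>
    have "M \<le> (real n - 1) * r" using nM(4) r by (simp add: field_simps)
    then have tM: "M < t" using t_ge by linarith
    have "real n * r \<le> t" using t_ge r by (simp add: algebra_simps)
    have "c * real n ^ (k - 1) = (2 * \<epsilon> * (real n * r) / real k) ^ (k - 1)"
      by (simp add: c_def mult_ac flip: power_mult_distrib)
    also have "\<dots> \<le> (2 * \<epsilon> * t / real k) ^ (k - 1)"
      using \<open>real n * r \<le> t\<close> \<epsilon> r k by (intro power_mono divide_right_mono mult_left_mono) auto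
    finally have few': "real (js (k + 1) n E) < (2 * \<epsilon> * real (card T) / real k) ^ (k - 1)"
      using few by (simp add: t_def)
    have deg: "(1 - 1 / real k - \<epsilon>) * real (card T) < real (card (nbrs T v))" if "v \<in> T" for v
      using T_deg tM that by (auto simp: t_def b_def diff_divide_distrib)
    obtain f :: "nat \<Rightarrow> nat" where f: "\<And>u. u \<in> T \<Longrightarrow> f u < k"
      "\<And>u v. u \<in> T \<Longrightarrow> v \<in> T \<Longrightarrow> E u v \<Longrightarrow> f u \<noteq> f v"
      using few_joints_imp_multipartite[OF E assms \<epsilon>_def T(1) finT(2) deg few'] by blast
    have "qmax T \<le> b * t"
      using multipartite_qmax_le[OF finT _ f] assms by (simp add: b_def t_def)
    moreover have "2 * b \<le> \<kappa> * (t - 1)"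
      using M(3) tM \<kappa> by (smt (verit) mult_left_mono)
    ultimately have "\<not> t + 1 \<le> real n"
      using no_deletion[of "qmax {..<n}" "real n" \<kappa> t "qmax T" b s] gain \<rho> b \<kappa> t2 s by (auto simp: t_def)
    then have "card {..<n} \<le> card T" by (simp add: t_def)
    then have TV: "T = {..<n}" using T(1) by (intro card_seteq) auto
    have "real n < q n (turan n k)"
    proof -
      have "4 / 3 * real n \<le> b * real n" using b by (intro mult_right_mono) auto
      then show ?thesis using qT s nM M by linarith
    qed
    then have "isomorphic n E (turan n k)"
      using multipartite_extremal[OF E _ n0 _ _ ge, where f = f] f assms by (auto simp: TV)
    then show False using not_iso by simp
  qed
  ultimately show ?thesis by (intro exI[of _ c] conjI exI[of _ n0]) auto
qed

end
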